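(* Given a collection of task samples $\{\tau_i\}_{i=1}^{\mathcal{B}}$ with $\tau_i\sim p(\tau)$ and the corresponding meta datasets, for $\epsilon\in(0,1)$ the following generalization bound in the presence of tail risk holds with probability at least $1-\epsilon$: $$R(\theta_* )\le\widehat{R}(\theta_* )+\sqrt{\frac{2\Big(\frac{\alpha}{1-\alpha}\mathcal{L}_{\max}^2+\mathbb{V}_{\tau_i\sim p_\alpha(\tau)}\big[\ell(\mathfrak{D}_{\tau_i}^{Q},\mathfrak{D}_{\tau_i}^{S};\theta_* )\big]\Big)\ln\left(\frac{1}{\epsilon}\right)}{\mathcal{B}}}+\frac{1}{3(1-\alpha)}\frac{\mathcal{L}_{\max}}{\mathcal{B}}\left(2\ln\left(\frac{1}{\epsilon}\right)+3\alpha\mathcal{B}\right).$$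
   Context: $p(\tau)$ is the task distribution (density) on the task set $\mathcal{T}$, $\Theta$ is the model parameter space, $\alpha\in[0,1)$; $\mathcal{B}$ is the number of sampled tasks; $\theta_*\in\Theta$ is the given meta-trained (equilibrium) parameter. Each task $\tau$ has a support set $\mathfrak{D}_\tau^S$ and a query set $\mathfrak{D}_\tau^Q$; the meta risk function $\ell$ takes values in $\mathbb{R}^+$ and evaluates performance after fast adaptation. $F_\ell(l;\theta):=\mathbb{P}_{\tau\sim p}(\ell(\mathfrak{D}_\tau^Q,\mathfrak{D}_\tau^S;\theta)\le l)$; $\mathrm{VaR}_\alpha[\ell(\mathcal{T},\theta)]:=\inf\{l\in\mathbb{R}^+:F_\ell(l;\theta)\ge\alpha\}$; $\Omega_{\alpha,\tau}=\{\tau:\ell(\mathfrak{D}_\tau^Q,\mathfrak{D}_\tau^S;\theta)\ge\mathrm{VaR}_\alpha[\ell(\mathcal{T},\theta)]\}$ is the tail risk task subspace; $p_\alpha(\tau;\theta)$ is the task distribution constrained to $\Omega_{\alpha,\tau}$ and normalized ($p(\tau)/(1-\alpha)$ on $\Omega_{\alpha,\tau}$, $0$ elsewhere); $p_\alpha(\tau)$ means $p_\alpha(\tau;\theta_* )$, whose support is contained in that of $p(\tau)$. $R(\theta_* )=\mathbb{E}_{p_\alpha(\tau)}[\ell(\mathfrak{D}_\tau^Q,\mathfrak{D}_\tau^S;\theta_* )]$ and $\widehat{R}(\theta_* )=\frac{1}{\mathcal{B}}\sum_{i=1}^{\mathcal{B}}\delta(\tau_i)\,\ell(\mathfrak{D}_{\tau_i}^Q,\mathfrak{D}_{\tau_i}^S;\theta_*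 )$. Here $\delta(\tau_i)=1[\ell(\mathfrak{D}_{\tau_i}^Q,\mathfrak{D}_{\tau_i}^S;\theta_* )\ge\hat{\xi}]$ is the indicator that the meta risk of $\tau_i$ falls into the tail risk region as determined by the estimated quantile $\hat{\xi}=\hat{F}^{-1}_{\text{MC-}\mathcal{B}}(\alpha)$, where $\hat{F}_{\text{MC-}\mathcal{B}}$ is the empirical distribution of the meta risk values over the $\mathcal{B}$ Monte Carlo task samples and $\hat{F}^{-1}_{\text{MC-}\mathcal{B}}(\alpha)$ is its $\alpha$-quantile. $\mathbb{V}$ denotes variance. Standing assumptions: (1) $\ell(\mathfrak{D}_\tau^Q,\mathfrak{D}_\tau^S;\theta)$ is $\beta_\tau$-Lipschitz continuous in $\theta$; (2) $F_\ell(l;\theta)$ is $\beta_\ell$-Lipschitz continuous in $l$ and $p_\alpha(\tau;\theta)$ is $\beta_\theta$-Lipschitz continuous in $\theta$; (3) for every valid $\theta\in\Theta$ and corresponding $p_\alpha(\tau;\theta)$, $\sup_{\tau\in\Omega_{\alpha,\tau}}\ell(\mathfrak{D}_\tau^Q,\mathfrak{D}_\tau^S;\theta)\le\mathcal{L}_{\max}$. *)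

theory Defs
  imports "HOL-Probability.Probability"
begin

text \<open>
  The task set is the space of a reference measure \<open>N\<close>, and \<open>p\<close> is a density with respect to \<open>N\<close>.
  The argument \<open>r\<close> is the meta risk as a function of the task and the model parameter,
  \<open>r \<tau> \<theta> = l (Q \<tau>) (S \<tau>) \<theta>\<close> for the query set \<open>Q \<tau>\<close> and the support set \<open>S \<tau>\<close> of \<open>\<tau>\<close>.
\<close>

definition risk_cdf ::
  "'t measure \<Rightarrow> ('t \<Rightarrow> real) \<Rightarrow> ('t \<Rightarrow> 'p \<Rightarrow> real) \<Rightarrow> 'p \<Rightarrow> real \<Rightarrow> real" where
  "risk_cdf N p r \<theta> x =
     measure (density N (\<lambda>\<tau>. ennreal (p \<tau>))) {\<tau> \<in> space N. r \<tau> \<theta> \<le> x}"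

text \<open>
  The infimum ranges over the nonnegative reals because risks are nonnegative. Hence the
  \<open>0\<close>-quantile of any distribution function is \<open>0\<close>.
\<close>

definition quantile :: "(real \<Rightarrow> real) \<Rightarrow> real \<Rightarrow> real" where
  "quantile F \<alpha> = Inf {x. 0 \<le> x \<and> \<alpha> \<le> F x}"

definition VaR ::
  "'t measure \<Rightarrow> ('t \<Rightarrow> real) \<Rightarrow> ('t \<Rightarrow> 'p \<Rightarrow> real) \<Rightarrow> real \<Rightarrow> 'p \<Rightarrow> real" where
  "VaR N p r \<alpha> \<theta> = quantile (risk_cdf N p r \<theta>) \<alpha>"

definition tail_region ::
  "'t measure \<Rightarrow> ('t \<Rightarrow> real) \<Rightarrow> ('t \<Rightarrow> 'p \<Rightarrow> real) \<Rightarrow> real \<Rightarrow> 'p \<Rightarrow> 't set" where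
  "tail_region N p r \<alpha> \<theta> = {\<tau> \<in> space N. VaR N p r \<alpha> \<theta> \<le> r \<tau> \<theta>}"

text \<open>
  The factor \<open>1 / (1 - \<alpha>)\<close> normalizes the restriction of \<open>p\<close> to the tail region whenever the
  distribution function of the risk is continuous on the whole real line.
\<close>

definition tail_density ::
  "'t measure \<Rightarrow> ('t \<Rightarrow> real) \<Rightarrow> ('t \<Rightarrow> 'p \<Rightarrow> real) \<Rightarrow> real \<Rightarrow> 't \<Rightarrow> 'p \<Rightarrow> real" where
  "tail_density N p r \<alpha> \<tau> \<theta> =
     (if \<tau> \<in> tail_region N p r \<alpha> \<theta> then p \<tau> / (1 - \<alpha>) else 0)"

definition tail_measure ::
  "'t measure \<Rightarrow> ('t \<Rightarrow> real) \<Rightarrow> ('t \<Rightarrow> 'p \<Rightarrow> real) \<Rightarrow> real \<Rightarrow> 'p \<Rightarrow> 't measure" where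
  "tail_measure N p r \<alpha> \<theta> = density N (\<lambda>\<tau>. ennreal (tail_density N p r \<alpha> \<tau> \<theta>))"

definition tail_risk ::
  "'t measure \<Rightarrow> ('t \<Rightarrow> real) \<Rightarrow> ('t \<Rightarrow> 'p \<Rightarrow> real) \<Rightarrow> real \<Rightarrow> 'p \<Rightarrow> real" where
  "tail_risk N p r \<alpha> \<theta> = prob_space.expectation (tail_measure N p r \<alpha> \<theta>) (\<lambda>\<tau>. r \<tau> \<theta>)"

definition tail_variance ::
  "'t measure \<Rightarrow> ('t \<Rightarrow> real) \<Rightarrow> ('t \<Rightarrow> 'p \<Rightarrow> real) \<Rightarrow> real \<Rightarrow> 'p \<Rightarrow> real" where
  "tail_variance N p r \<alpha> \<theta> = prob_space.variance (tail_measure N p r \<alpha> \<theta>) (\<lambda>\<tau>. r \<tau> \<theta>)"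

definition empirical_cdf :: "nat \<Rightarrow> (nat \<Rightarrow> real) \<Rightarrow> real \<Rightarrow> real" where
  "empirical_cdf B x y = real (card {i \<in> {1..B}. x i \<le> y}) / real B"

text \<open>
  The quantile is estimated from the sample \<open>x 1, \<dots>, x B\<close> that is also averaged. The sum is
  divided by the full sample size \<open>B\<close>, not by the number of samples in the estimated tail.
\<close>

definition empirical_tail_risk :: "real \<Rightarrow> nat \<Rightarrow> (nat \<Rightarrow> real) \<Rightarrow> real" where
  "empirical_tail_risk \<alpha> B x =
     (1 / real B) * (\<Sum>i=1..B. of_bool (quantile (empirical_cdf B x) \<alpha> \<le> x i) * x i)"

end

theory Submission
  imports Defs
begin

text \<open>
  Write \<open>L\<close> for \<open>Lmax\<close>, \<open>\<xi>\<close> for the \<open>\<alpha>\<close>-quantile, \<open>\<mu>\<close> for the law of the risk and \<open>\<nu>\<close> for its tail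
  law, with mean \<open>R\<close> and variance \<open>V\<close>. Since \<open>\<mu>\<close> has no atoms, it is the mixture of \<open>\<nu>\<close> with weight
  \<open>1 - \<alpha>\<close> and of a law below \<open>\<xi>\<close>. So draw \<open>u i\<close> from \<open>\<nu>\<close> and \<open>v i\<close> from \<open>\<mu>\<close>, all independent, and
  realize the sample as \<open>x i = (if \<xi> \<le> v i then u i else v i)\<close>. With \<open>J\<close> the number of samples below
  \<open>\<xi>\<close>, the estimator satisfies the deterministic inequality
  \<open>B * empirical_tail_risk \<alpha> B x \<ge> (\<Sum>i. u i) - L * max J (\<alpha> * B)\<close>, whatever the estimated quantile is.
  Failure of the bound therefore forces \<open>G + max 0 H\<close> to be large for the independent centred sums
  \<open>G = (\<Sum>i. R - u i)\<close> and \<open>H = L * (J - \<alpha> * B)\<close>, whose variances add up to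
  \<open>B * (V + \<alpha> * (1 - \<alpha>) * L\<^sup>2)\<close>, and \<open>G + max 0 H\<close> obeys the same Bernstein bound as \<open>G + H\<close>.
\<close>

section \<open>Bernstein's inequality, with a positive part around one block of summands\<close>

text \<open>For \<open>y \<le> 0\<close> the second-order Taylor bound suffices. For
  \<open>y > 0\<close> the exponential series from its quadratic term on is dominated by a geometric
  series of ratio \<open>y / 3\<close>, because \<open>fact (n + 2)\<close> is at least
  \<open>2 * 3 ^ n\<close>; this ratio is the source of the third in Bernstein's inequality.\<close>

lemma exp_le_quadratic:
  fixes y c :: real
  assumes "y \<le> c" "0 \<le> c" "c < 3"
  shows "exp y \<le> 1 + y + y\<^sup>2 / (2 * (1 - c / 3))"
proof (cases "y \<le> 0")
  case True
  have "exp y \<le> 1 + y + y\<^sup>2 / 2"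
  proof -
    have "(\<lambda>z. exp z - 1 - z - z\<^sup>2 / 2) y \<le> (\<lambda>z. exp z - 1 - z - z\<^sup>2 / 2) 0"
    proof (rule DERIV_nonneg_imp_nondecreasing[OF True])
      fix z :: real
      have "((\<lambda>z. exp z - 1 - z - z\<^sup>2 / 2) has_real_derivative exp z - 1 - z) (at z)"
        by (auto intro!: derivative_eq_intros)
      moreover have "0 \<le> exp z - 1 - z" using exp_ge_add_one_self[of z] by linarith
      ultimately show "\<exists>d. ((\<lambda>z. exp z - 1 - z - z\<^sup>2 / 2) has_real_derivative d) (at z) \<and> 0 \<le> d"
        by blast
    qed
    then show ?thesis by simp
  qed
  also have "y\<^sup>2 / 2 \<le> y\<^sup>2 / (2 * (1 - c / 3))"
    using assms by (intro divide_left_mono) auto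
  finally show ?thesis by simp
next
  case False
  have s1: "summable (\<lambda>n. y ^ (n + 2) / fact (n + 2))"
    using summable_exp[of y] by (subst summable_iff_shift) (simp add: field_simps)
  have fact_ge: "2 * 3 ^ n \<le> (fact (n + 2) :: real)" for n
  proof (induction n)
    case (Suc n)
    have "2 * 3 ^ Suc n \<le> 3 * (fact (n + 2) :: real)" unfolding power_Suc using Suc.IH by linarith
    also have "\<dots> \<le> (real n + 3) * fact (n + 2)" by (intro mult_right_mono) auto
    finally show ?case by (simp add: algebra_simps)
  qed (simp add: numeral_2_eq_2)
  have geo: "(\<lambda>n. y\<^sup>2 / 2 * (y / 3) ^ n) sums (y\<^sup>2 / 2 * (1 / (1 - y / 3)))"
    using assms False by (intro sums_mult geometric_sums) auto
  have "(\<Sum>n. y ^ (n + 2) / fact (n + 2)) \<le> (\<Sum>n. y\<^sup>2 / 2 * (y / 3) ^ n)"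
  proof (rule suminf_le[OF _ s1 sums_summable[OF geo]])
    fix n
    have "y ^ (n + 2) / fact (n + 2) \<le> y ^ (n + 2) / (2 * 3 ^ n)"
      using False fact_ge by (intro divide_left_mono) auto
    then show "y ^ (n + 2) / fact (n + 2) \<le> y\<^sup>2 / 2 * (y / 3) ^ n"
      by (simp add: power_divide power_add power2_eq_square field_simps)
  qed
  also have "\<dots> = y\<^sup>2 / (2 * (1 - y / 3))" using sums_unique[OF geo] by simp
  also have "\<dots> \<le> y\<^sup>2 / (2 * (1 - c / 3))"
    using assms by (intro divide_left_mono) auto
  finally have "(\<Sum>n. y ^ (n + 2) / fact (n + 2)) \<le> y\<^sup>2 / (2 * (1 - c / 3))" .
  moreover have "exp y = (\<Sum>n. y ^ n / fact n)"
    by (simp add: exp_def divide_inverse mult.commute)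
  moreover have "summable (\<lambda>n. y ^ n / fact n)"
    using summable_exp[of y] by (simp add: field_simps)
  then have "(\<Sum>n. y ^ n / fact n) = (\<Sum>n. y ^ (n + 2) / fact (n + 2)) + (\<Sum>n<2. y ^ n / fact n)"
    by (rule suminf_split_initial_segment)
  ultimately show ?thesis by (simp add: numeral_2_eq_2)
qed

lemma (in prob_space) integrable_AE_bounded:
  fixes X :: "'a \<Rightarrow> real"
  assumes "random_variable borel X" "AE x in M. \<bar>X x\<bar> \<le> b"
  shows "integrable M X"
  using assms by (intro integrable_const_bound[of _ b]) auto

text \<open>Averaging the quadratic bound on \<open>exp\<close> removes the linear term, as the mean
  is zero, and \<open>1 + z \<le> exp z\<close> restores an exponential. The lower bound
  \<open>1\<close> is Jensen's inequality for a centred variable.\<close>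

lemma (in prob_space) Bernstein_mgf:
  fixes X :: "'a \<Rightarrow> real"
  assumes X[measurable]: "random_variable borel X"
    and bnd: "AE x in M. \<bar>X x\<bar> \<le> b"
    and mean: "expectation X = 0" and var: "expectation (\<lambda>x. (X x)\<^sup>2) \<le> v"
    and l: "0 \<le> l" "l * b < 3" and b: "0 \<le> b"
  shows "integrable M (\<lambda>x. exp (l * X x))"
    and "1 \<le> expectation (\<lambda>x. exp (l * X x))"
    and "expectation (\<lambda>x. exp (l * X x)) \<le> exp (l\<^sup>2 * v / (2 * (1 - l * b / 3)))"
proof -
  let ?k = "1 / (2 * (1 - l * b / 3))"
  have k: "0 \<le> ?k" by (intro divide_nonneg_nonneg mult_nonneg_nonneg) (use l in linarith)+
  show int: "integrable M (\<lambda>x. exp (l * X x))"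
    using bnd l b by (intro integrable_AE_bounded[of _ "exp (l * b)"])
      (auto intro!: mult_left_mono elim!: eventually_mono)
  have intX: "integrable M X" by (rule integrable_AE_bounded[OF X bnd])
  have intX2: "integrable M (\<lambda>x. (X x)\<^sup>2)"
    using bnd by (intro integrable_AE_bounded[of _ "b\<^sup>2"])
      (auto elim!: eventually_mono dest: power_mono[OF _ abs_ge_zero, where n = 2])
  have "expectation (\<lambda>x. 1 + l * X x) \<le> expectation (\<lambda>x. exp (l * X x))"
    by (intro integral_mono int) (auto simp: intX)
  then show "1 \<le> expectation (\<lambda>x. exp (l * X x))"
    using intX mean by (simp add: prob_space)
  have "expectation (\<lambda>x. exp (l * X x)) \<le> expectation (\<lambda>x. 1 + l * X x + (l\<^sup>2 * ?k) * (X x)\<^sup>2)"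
  proof (rule integral_mono_AE[OF int])
    show "AE x in M. exp (l * X x) \<le> 1 + l * X x + (l\<^sup>2 * ?k) * (X x)\<^sup>2"
      using bnd
    proof eventually_elim
      case (elim x)
      then have "l * X x \<le> l * b" using l by (intro mult_left_mono) auto
      from exp_le_quadratic[OF this] l b show ?case by (simp add: power_mult_distrib)
    qed
  qed (use intX intX2 in auto)
  also have "\<dots> = 1 + (l\<^sup>2 * ?k) * expectation (\<lambda>x. (X x)\<^sup>2)"
    using intX intX2 mean by (simp add: prob_space)
  also have "\<dots> \<le> 1 + (l\<^sup>2 * ?k) * v"
    using k var by (intro add_left_mono mult_left_mono) auto
  also have "\<dots> \<le> exp (l\<^sup>2 * ?k * v)" by (rule exp_ge_add_one_self)
  finally show "expectation (\<lambda>x. exp (l * X x)) \<le> exp (l\<^sup>2 * v / (2 * (1 - l * b / 3)))"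
    by simp
qed

text \<open>Independence factorizes the exponential moment of the sum, so all three properties of a
  single summand carry over.\<close>

lemma (in prob_space) Bernstein_mgf_sum:
  fixes Z :: "'i \<Rightarrow> 'a \<Rightarrow> real"
  assumes ind: "indep_vars (\<lambda>_. borel) Z I" and fin: "finite I"
    and bnd: "\<And>i. i \<in> I \<Longrightarrow> AE x in M. \<bar>Z i x\<bar> \<le> b"
    and mean: "\<And>i. i \<in> I \<Longrightarrow> expectation (Z i) = 0"
    and var: "\<And>i. i \<in> I \<Longrightarrow> expectation (\<lambda>x. (Z i x)\<^sup>2) \<le> v i"
    and l: "0 \<le> l" "l * b < 3" and b: "0 \<le> b"
  shows "integrable M (\<lambda>x. exp (l * (\<Sum>i\<in>I. Z i x)))"
    and "1 \<le> expectation (\<lambda>x. exp (l * (\<Sum>i\<in>I. Z i x)))"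
    and "expectation (\<lambda>x. exp (l * (\<Sum>i\<in>I. Z i x)))
           \<le> exp (l\<^sup>2 * (\<Sum>i\<in>I. v i) / (2 * (1 - l * b / 3)))"
proof -
  have rv: "random_variable borel (Z i)" if "i \<in> I" for i
    using ind that by (auto simp: indep_vars_def)
  note single = Bernstein_mgf[OF rv bnd mean var l b]
  have ind': "indep_vars (\<lambda>_. borel) (\<lambda>i x. exp (l * Z i x)) I"
    by (rule indep_vars_compose2[OF ind]) simp
  have eq: "exp (l * (\<Sum>i\<in>I. Z i x)) = (\<Prod>i\<in>I. exp (l * Z i x))" for x
    using fin by (simp add: exp_sum sum_distrib_left)
  show "integrable M (\<lambda>x. exp (l * (\<Sum>i\<in>I. Z i x)))"
    unfolding eq by (rule indep_vars_integrable[OF fin ind']) (rule single)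
  have E: "expectation (\<lambda>x. exp (l * (\<Sum>i\<in>I. Z i x))) = (\<Prod>i\<in>I. expectation (\<lambda>x. exp (l * Z i x)))"
    unfolding eq by (rule indep_vars_lebesgue_integral[OF fin ind']) (rule single)
  show "1 \<le> expectation (\<lambda>x. exp (l * (\<Sum>i\<in>I. Z i x)))"
    unfolding E by (intro prod_ge_1 single)
  have "(\<Prod>i\<in>I. expectation (\<lambda>x. exp (l * Z i x))) \<le> (\<Prod>i\<in>I. exp (l\<^sup>2 * v i / (2 * (1 - l * b / 3))))"
    by (intro prod_mono conjI single Bochner_Integration.integral_nonneg) auto
  also have "\<dots> = exp (l\<^sup>2 * (\<Sum>i\<in>I. v i) / (2 * (1 - l * b / 3)))"
    using fin by (simp add: exp_sum sum_distrib_left sum_divide_distrib)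
  finally show "expectation (\<lambda>x. exp (l * (\<Sum>i\<in>I. Z i x)))
           \<le> exp (l\<^sup>2 * (\<Sum>i\<in>I. v i) / (2 * (1 - l * b / 3)))"
    unfolding E .
qed

text \<open>
  Conditioning on \<open>G\<close> and then applying Markov's inequality to \<open>H\<close> avoids the moment generating
  function of \<open>max 0 H\<close>, which is larger than that of \<open>H\<close>.
\<close>

lemma (in prob_space) Chernoff_add_pos_part:
  fixes G H :: "'a \<Rightarrow> real"
  assumes ind: "indep_var borel G borel H"
    and intG: "integrable M (\<lambda>x. exp (l * G x))" and intH: "integrable M (\<lambda>x. exp (l * H x))"
    and one: "1 \<le> expectation (\<lambda>x. exp (l * H x))" and l: "0 \<le> l"
  shows "prob {x \<in> space M. s \<le> G x + max 0 (H x)}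
           \<le> exp (- l * s) * expectation (\<lambda>x. exp (l * G x)) * expectation (\<lambda>x. exp (l * H x))"
proof -
  have G[measurable]: "random_variable borel G" and H[measurable]: "random_variable borel H"
    and D: "distr M borel G \<Otimes>\<^sub>M distr M borel H = distr M (borel \<Otimes>\<^sub>M borel) (\<lambda>x. (G x, H x))"
    using ind[unfolded indep_var_distribution_eq] by auto
  interpret G: prob_space "distr M borel G" by (rule prob_space_distr) simp
  interpret H: prob_space "distr M borel H" by (rule prob_space_distr) simp
  interpret GH: pair_prob_space "distr M borel G" "distr M borel H" ..
  define c where "c = expectation (\<lambda>x. exp (l * H x))"
  define A where "A = {z::real\<times>real. s \<le> fst z + max 0 (snd z)}"
  have A[measurable]: "A \<in> sets (borel \<Otimes>\<^sub>M borel)"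
  proof -
    have "A = {z \<in> space (borel \<Otimes>\<^sub>M borel). s \<le> fst z + max 0 (snd z)}"
      by (simp add: A_def space_pair_measure)
    then show ?thesis by simp
  qed
  \<comment> \<open>If \<open>y\<close> reaches \<open>s\<close> on its own, the right-hand side is
    at least \<open>1\<close>, which is where \<open>one\<close> enters. Otherwise
    \<open>s \<le> y + max 0 z\<close> forces \<open>z > 0\<close>, so the positive part disappears
    and Markov's inequality applies to \<open>exp (l * z)\<close>.\<close>
  have inner: "emeasure (distr M borel H) (Pair y -` A) \<le> ennreal (exp (l * (y - s)) * c)" for y
  proof (cases "s \<le> y")
    case True
    then have "1 * 1 \<le> exp (l * (y - s)) * c"
      using l one unfolding c_def by (intro mult_mono) auto
    then have "ennreal 1 \<le> ennreal (exp (l * (y - s)) * c)" by (intro ennreal_leI) simp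
    then show ?thesis by (metis H.emeasure_le_1 ennreal_1 order_trans)
  next
    case False
    have "emeasure (distr M borel H) (Pair y -` A)
        \<le> (\<integral>\<^sup>+z. ennreal (exp (l * (y - s)) * exp (l * z)) \<partial>distr M borel H)"
    proof -
      have "emeasure (distr M borel H) (Pair y -` A)
          = (\<integral>\<^sup>+z. indicator (Pair y -` A) z \<partial>distr M borel H)"
        by (rule nn_integral_indicator[symmetric]) (simp add: sets_Pair1[OF A])
      also have "\<dots> \<le> (\<integral>\<^sup>+z. ennreal (exp (l * (y - s)) * exp (l * z)) \<partial>distr M borel H)"
      proof (rule nn_integral_mono)
        fix z
        have "1 \<le> exp (l * (y - s)) * exp (l * z)" if "(y, z) \<in> A"
        proof -
          have "0 \<le> l * (y - s + z)" using that False l by (auto simp: A_def max_def split: if_splits)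
          then show ?thesis by (simp add: exp_add[symmetric] algebra_simps)
        qed
        then show "indicator (Pair y -` A) z \<le> ennreal (exp (l * (y - s)) * exp (l * z))"
          by (auto simp: indicator_def simp del: ennreal_1 simp flip: ennreal_1 intro!: ennreal_leI)
      qed
      finally show ?thesis .
    qed
    also have "\<dots> = (\<integral>\<^sup>+x. ennreal (exp (l * (y - s)) * exp (l * H x)) \<partial>M)"
      by (subst nn_integral_distr) auto
    also have "\<dots> = ennreal (expectation (\<lambda>x. exp (l * (y - s)) * exp (l * H x)))"
      using intH by (intro nn_integral_eq_integral) auto
    finally show ?thesis by (simp add: c_def)
  qed
  have "emeasure M {x \<in> space M. s \<le> G x + max 0 (H x)}
      = emeasure (distr M (borel \<Otimes>\<^sub>M borel) (\<lambda>x. (G x, H x))) A"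
    by (subst emeasure_distr[OF _ A]) (simp, auto simp: A_def intro!: arg_cong[where f="emeasure M"])
  also have "\<dots> = (\<integral>\<^sup>+y. emeasure (distr M borel H) (Pair y -` A) \<partial>distr M borel G)"
    unfolding D[symmetric] by (rule H.emeasure_pair_measure_alt) simp
  also have "\<dots> \<le> (\<integral>\<^sup>+y. ennreal (exp (l * (y - s)) * c) \<partial>distr M borel G)"
    by (intro nn_integral_mono inner)
  also have "\<dots> = (\<integral>\<^sup>+x. ennreal ((exp (- l * s) * c) * exp (l * G x)) \<partial>M)"
    by (subst nn_integral_distr) (auto simp: exp_diff exp_minus field_simps)
  also have "\<dots> = ennreal (expectation (\<lambda>x. (exp (- l * s) * c) * exp (l * G x)))"
    using intG one by (intro nn_integral_eq_integral) (auto simp: c_def)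
  finally have "emeasure M {x \<in> space M. s \<le> G x + max 0 (H x)}
      \<le> ennreal (exp (- l * s) * expectation (\<lambda>x. exp (l * G x)) * c)"
    by (simp add: mult_ac)
  then show ?thesis
    using one unfolding emeasure_eq_measure c_def
    by (subst (asm) ennreal_le_iff) (auto intro!: mult_nonneg_nonneg)
qed

text \<open>The letters \<open>w\<close>, \<open>q\<close>, \<open>c\<close> stand for
  \<open>sqrt V\<close>, \<open>sqrt (2 * t)\<close> and \<open>b / 3\<close>. The factor 2 in the
  denominator of \<open>l\<close> keeps \<open>l * c\<close> below 1 even for \<open>w = 0\<close>.
  With \<open>a = c * q\<close> the claim comes down to
  \<open>w\<^sup>2 + (w + a) * (w + 2 * a) \<le> 2 * (w + a)\<^sup>2\<close>, whose two sides differ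
  by \<open>w * a\<close>.\<close>

lemma Bernstein_exponent:
  fixes w c q :: real
  assumes "0 \<le> w" "0 < c" "0 < q"
  defines "l \<equiv> q / (w + 2 * c * q)"
  shows "0 \<le> l" "l * c < 1"
    and "- l * (w * q + c * q\<^sup>2) + l\<^sup>2 * w\<^sup>2 / (2 * (1 - l * c)) \<le> - q\<^sup>2 / 2"
proof -
  have p: "0 < c * q" "0 < w + 2 * c * q" "0 < w + c * q" using assms
    by (auto intro!: add_nonneg_pos)
  show "0 \<le> l" using assms p by (simp add: l_def)
  show lc: "l * c < 1" using p assms by (simp add: l_def field_simps)
  define a where "a = c * q"
  have a: "0 < a" "0 < w + 2 * a" "0 < w + a" using p by (auto simp: a_def)
  have l: "l = q / (w + 2 * a)" by (simp add: l_def a_def)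
  have "1 - l * c = (w + a) / (w + 2 * a)"
    using a p by (simp add: l a_def field_simps)
  then have "l\<^sup>2 * w\<^sup>2 / (2 * (1 - l * c)) = q\<^sup>2 * w\<^sup>2 / (2 * (w + a) * (w + 2 * a))"
  proof -
    have *: "(q / d)\<^sup>2 * w\<^sup>2 / (2 * (e / d)) = q\<^sup>2 * w\<^sup>2 / (2 * e * d)" if "0 < d" "0 < e" for d e
      using that by (simp add: power2_eq_square field_simps)
    show ?thesis if "1 - l * c = (w + a) / (w + 2 * a)"
      unfolding that unfolding l using *[OF a(2,3)] by simp
  qed
  moreover have "l * (w * q + c * q\<^sup>2) = q\<^sup>2 * (w + a) / (w + 2 * a)"
    by (simp add: l a_def power2_eq_square field_simps)
  moreover have "q\<^sup>2 * w\<^sup>2 / (2 * (w + a) * (w + 2 * a)) + q\<^sup>2 / 2 \<le> q\<^sup>2 * (w + a) / (w + 2 * a)"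
  proof -
    have "w\<^sup>2 + (w + a) * (w + 2 * a) \<le> 2 * (w + a)\<^sup>2"
      using assms a by (simp add: power2_eq_square algebra_simps)
    then have "q\<^sup>2 * (w\<^sup>2 + (w + a) * (w + 2 * a)) / (2 * (w + a) * (w + 2 * a))
        \<le> q\<^sup>2 * (2 * (w + a)\<^sup>2) / (2 * (w + a) * (w + 2 * a))"
      using a by (intro divide_right_mono mult_left_mono) auto
    moreover have "q\<^sup>2 * (w\<^sup>2 + (w + a) * (w + 2 * a)) / (2 * (w + a) * (w + 2 * a))
        = q\<^sup>2 * w\<^sup>2 / (2 * (w + a) * (w + 2 * a)) + q\<^sup>2 / 2"
      using a by (simp add: divide_simps) (simp add: algebra_simps)
    moreover have "q\<^sup>2 * (2 * (w + a)\<^sup>2) / (2 * (w + a) * (w + 2 * a)) = q\<^sup>2 * (w + a) / (w + 2 * a)"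
    proof -
      have "q\<^sup>2 * (2 * e\<^sup>2) / (2 * e * d) = q\<^sup>2 * e / d" if "0 < e" for d e
        using that by (simp add: power2_eq_square)
      then show ?thesis using a(3) .
    qed
    ultimately show ?thesis by simp
  qed
  ultimately show "- l * (w * q + c * q\<^sup>2) + l\<^sup>2 * w\<^sup>2 / (2 * (1 - l * c)) \<le> - q\<^sup>2 / 2"
    by simp
qed

text \<open>One multiplier \<open>l\<close> serves both blocks, so their variances add up under a
  single square root despite the positive part around the sum over \<open>J\<close>.\<close>

lemma (in prob_space) Bernstein_add_pos_part:
  fixes Z :: "'i \<Rightarrow> 'a \<Rightarrow> real"
  assumes ind: "indep_vars (\<lambda>_. borel) Z (I \<union> J)" and fin: "finite I" "finite J" and disj: "I \<inter> J = {}"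
    and bnd: "\<And>i. i \<in> I \<union> J \<Longrightarrow> AE x in M. \<bar>Z i x\<bar> \<le> b"
    and mean: "\<And>i. i \<in> I \<union> J \<Longrightarrow> expectation (Z i) = 0"
    and var: "\<And>i. i \<in> I \<union> J \<Longrightarrow> expectation (\<lambda>x. (Z i x)\<^sup>2) \<le> v i"
    and b: "0 < b" and t: "0 < t" and V: "(\<Sum>i\<in>I \<union> J. v i) \<le> V"
    and s: "sqrt (2 * V * t) + 2 * b * t / 3 \<le> s"
  shows "prob {x \<in> space M. s \<le> (\<Sum>i\<in>I. Z i x) + max 0 (\<Sum>i\<in>J. Z i x)} \<le> exp (- t)"
proof -
  \<comment> \<open>Then \<open>w * q = sqrt (2 * V * t)\<close>,
    \<open>c * q\<^sup>2 = 2 * b * t / 3\<close> and \<open>q\<^sup>2 / 2 = t\<close>, so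
    \<open>s\<close> dominates the threshold in \<open>Bernstein_exponent\<close>.\<close>
  define w q c where "w = sqrt V" and "q = sqrt (2 * t)" and "c = b / 3"
  define l where "l = q / (w + 2 * c * q)"
  have "0 \<le> v i" if "i \<in> I \<union> J" for i
    by (intro order_trans[OF _ var[OF that]] Bochner_Integration.integral_nonneg) simp
  then have "0 \<le> (\<Sum>i\<in>I \<union> J. v i)" by (rule sum_nonneg)
  then have V0: "0 \<le> V" using V by linarith
  have wqc: "0 \<le> w" "0 < c" "0 < q" using V0 b t by (auto simp: w_def c_def q_def)
  have l: "0 \<le> l" "l * b < 3"
    and ex: "- l * (w * q + c * q\<^sup>2) + l\<^sup>2 * w\<^sup>2 / (2 * (1 - l * c)) \<le> - q\<^sup>2 / 2"
    using Bernstein_exponent[OF wqc, folded l_def] by (simp_all add: c_def)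
  have indI: "indep_vars (\<lambda>_. borel) Z I" and indJ: "indep_vars (\<lambda>_. borel) Z J"
    by (rule indep_vars_subset[OF ind]; simp)+
  note mI = Bernstein_mgf_sum[OF indI fin(1) bnd mean var l less_imp_le[OF b]]
  note mJ = Bernstein_mgf_sum[OF indJ fin(2) bnd mean var l less_imp_le[OF b]]
  have "indep_var
    borel ((\<lambda>f. \<Sum>i\<in>I. f i) \<circ> (\<lambda>\<omega>. restrict (\<lambda>i. Z i \<omega>) I))
    borel ((\<lambda>f. \<Sum>i\<in>J. f i) \<circ> (\<lambda>\<omega>. restrict (\<lambda>i. Z i \<omega>) J))"
    using disj by (intro indep_var_compose[OF indep_var_restrict[OF ind]]) auto
  then have GH: "indep_var borel (\<lambda>x. \<Sum>i\<in>I. Z i x) borel (\<lambda>x. \<Sum>i\<in>J. Z i x)"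
    by (simp add: comp_def)
  have "prob {x \<in> space M. s \<le> (\<Sum>i\<in>I. Z i x) + max 0 (\<Sum>i\<in>J. Z i x)}
      \<le> exp (- l * s) * expectation (\<lambda>x. exp (l * (\<Sum>i\<in>I. Z i x)))
          * expectation (\<lambda>x. exp (l * (\<Sum>i\<in>J. Z i x)))"
    by (rule Chernoff_add_pos_part[OF GH]) (use mI mJ l in auto)
  also have "\<dots> \<le> exp (- l * s) * exp (l\<^sup>2 * (\<Sum>i\<in>I. v i) / (2 * (1 - l * b / 3)))
          * exp (l\<^sup>2 * (\<Sum>i\<in>J. v i) / (2 * (1 - l * b / 3)))"
    by (intro mult_mono mI mJ order_refl mult_nonneg_nonneg) auto
  also have "\<dots> = exp (- l * s + l\<^sup>2 * (\<Sum>i\<in>I \<union> J. v i) / (2 * (1 - l * b / 3)))"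
    using fin disj
    by (simp add: sum.union_disjoint exp_add[symmetric] add_divide_distrib[symmetric] algebra_simps)
  also have "\<dots> \<le> exp (- t)"
  proof -
    have "l * (w * q + c * q\<^sup>2) \<le> l * s"
    proof (rule mult_left_mono[OF _ l(1)])
      have "q\<^sup>2 = 2 * t" using t by (simp add: q_def)
      moreover have "w * q = sqrt (2 * V * t)" by (simp add: w_def q_def real_sqrt_mult)
      ultimately show "w * q + c * q\<^sup>2 \<le> s" using s by (simp add: c_def)
    qed
    moreover have "l\<^sup>2 * (\<Sum>i\<in>I \<union> J. v i) / (2 * (1 - l * b / 3)) \<le> l\<^sup>2 * w\<^sup>2 / (2 * (1 - l * c))"
    proof -
      have "w\<^sup>2 = V" using V0 by (simp add: w_def)
      moreover have "l * b / 3 = l * c" by (simp add: c_def)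
      moreover have "0 \<le> 2 * (1 - l * c)"
        using Bernstein_exponent(2)[OF wqc, folded l_def] by (simp add: algebra_simps)
      moreover have "l\<^sup>2 * (\<Sum>i\<in>I \<union> J. v i) \<le> l\<^sup>2 * V" using V by (rule mult_left_mono) simp
      ultimately show ?thesis by (simp only: divide_right_mono)
    qed
    moreover have "q\<^sup>2 / 2 = t" using t by (simp add: q_def)
    ultimately show ?thesis using ex by simp
  qed
  finally show ?thesis .
qed

section \<open>The estimated quantile and a deterministic lower bound for the estimator\<close>

text \<open>Trading the infimum for a count turns membership in the estimated tail into a condition
  on ranks, which serves both the deterministic inequality and measurability. The condition
  \<open>0 \<le> x i\<close> reflects that \<open>quantile\<close> ranges over nonnegative
  levels.\<close>

lemma quantile_empirical_cdf_le_iff: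
  assumes \<alpha>: "\<alpha> \<le> 1" and i: "i \<in> {1..B}"
  shows "quantile (empirical_cdf B x) \<alpha> \<le> x i
    \<longleftrightarrow> 0 \<le> x i \<and> \<alpha> * real B \<le> real (card {k \<in> {1..B}. x k \<le> x i})"
proof -
  define F where "F = empirical_cdf B x"
  define S where "S = {y. 0 \<le> y \<and> \<alpha> \<le> F y}"
  have B: "0 < real B" using i by auto
  have F: "\<alpha> \<le> F y \<longleftrightarrow> \<alpha> * real B \<le> real (card {k \<in> {1..B}. x k \<le> y})" for y
    using B by (simp add: F_def empirical_cdf_def field_simps)
  \<comment> \<open>Adjoining \<open>0\<close> makes \<open>m\<close> an admissible level even if
    all samples are negative. The empirical distribution function is 1 there, so the infimum is
    taken over a nonempty set.\<close>
  define m where "m = Max (insert 0 (x ` {1..B}))"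
  have "x k \<le> m" if "k \<in> {1..B}" for k
    unfolding m_def by (rule Max_ge) (use that in auto)
  then have "{k \<in> {1..B}. x k \<le> m} = {1..B}" by auto
  moreover have "\<alpha> * real B \<le> 1 * real B" using \<alpha> by (intro mult_right_mono) auto
  ultimately have "m \<in> S" by (simp add: S_def F m_def)
  then have ne: "S \<noteq> {}" by auto
  have bdd: "bdd_below S" by (auto simp: S_def)
  have q: "quantile (empirical_cdf B x) \<alpha> = Inf S" by (simp add: quantile_def S_def F_def)
  have q0: "0 \<le> Inf S" by (rule cInf_greatest[OF ne]) (simp add: S_def)
  show ?thesis
  proof (intro iffI conjI)
    assume "0 \<le> x i \<and> \<alpha> * real B \<le> real (card {k \<in> {1..B}. x k \<le> x i})"
    then have "x i \<in> S" by (simp add: S_def F)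
    then show "quantile (empirical_cdf B x) \<alpha> \<le> x i" unfolding q using bdd by (rule cInf_lower)
  next
    assume le: "quantile (empirical_cdf B x) \<alpha> \<le> x i"
    then show "0 \<le> x i" using q q0 by linarith
    show "\<alpha> * real B \<le> real (card {k \<in> {1..B}. x k \<le> x i})"
    proof (rule ccontr)
      assume "\<not> ?thesis"
      then have less: "real (card {k \<in> {1..B}. x k \<le> x i}) < \<alpha> * real B" by simp
      \<comment> \<open>The empirical distribution function can grow beyond its value at
        \<open>x i\<close> only by reaching a sample value above \<open>x i\<close>, so every level
        in \<open>S\<close> is at least some element of \<open>C\<close>. Finiteness of
        \<open>C\<close> then keeps the infimum strictly above \<open>x i\<close>.\<close>
      define C where "C = {x k | k. k \<in> {1..B} \<and> x i < x k}"
      have finC: "finite C" by (simp add: C_def)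
      have ex: "\<exists>c\<in>C. c \<le> y" if "y \<in> S" for y
      proof -
        have "card {k \<in> {1..B}. x k \<le> x i} < card {k \<in> {1..B}. x k \<le> y}"
          using less that by (simp add: S_def F)
        then have "\<not> {k \<in> {1..B}. x k \<le> y} \<subseteq> {k \<in> {1..B}. x k \<le> x i}"
          using card_mono[of "{k \<in> {1..B}. x k \<le> x i}" "{k \<in> {1..B}. x k \<le> y}"] by auto
        then obtain k where "k \<in> {1..B}" "x k \<le> y" "x i < x k" by fastforce
        then show ?thesis by (auto simp: C_def)
      qed
      then have "C \<noteq> {}" using ne by auto
      then have "x i < Min C" using finC by (subst Min_gr_iff) (auto simp: C_def)
      also have "Min C \<le> Inf S"
        using ne by (rule cInf_greatest) (meson ex Min_le[OF finC] order_trans)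
      finally show False using le q by simp
    qed
  qed
qed

text \<open>Only samples that are excluded from the estimated tail or lie below \<xi> can cost
  anything, each at most \<open>L\<close>. The two arguments of \<open>max\<close> belong to the two
  cases: either every excluded sample is below \<xi>, or some excluded sample is not.\<close>

lemma sum_le_empirical_tail_risk:
  assumes \<alpha>: "0 \<le> \<alpha>" "\<alpha> \<le> 1" and B: "1 \<le> B"
    and x: "\<And>i. i \<in> {1..B} \<Longrightarrow> 0 \<le> x i"
    and u: "\<And>i. i \<in> {1..B} \<Longrightarrow> u i \<le> L"
    and eq: "\<And>i. i \<in> {1..B} \<Longrightarrow> \<xi> \<le> x i \<Longrightarrow> u i = x i" and L: "0 \<le> L"
  shows "(\<Sum>i=1..B. u i) \<le> real B * empirical_tail_risk \<alpha> B x
           + L * max (\<Sum>i=1..B. of_bool (x i < \<xi>)) (\<alpha> * real B)"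
proof -
  define In where "In = {i \<in> {1..B}. quantile (empirical_cdf B x) \<alpha> \<le> x i}"
  define Out where "Out = {1..B} - In"
  define Low where "Low = {i \<in> {1..B}. x i < \<xi>}"
  have fin: "finite In" "finite Out" "finite Low" by (auto simp: In_def Out_def Low_def)
  have In: "In = {i \<in> {1..B}. \<alpha> * real B \<le> real (card {k \<in> {1..B}. x k \<le> x i})}"
    using x \<alpha> quantile_empirical_cdf_le_iff[of \<alpha> _ B x] by (auto simp: In_def)
  have A: "real B * empirical_tail_risk \<alpha> B x = (\<Sum>i\<in>In. x i)"
  proof -
    have "(\<Sum>i=1..B. of_bool (quantile (empirical_cdf B x) \<alpha> \<le> x i) * x i)
        = (\<Sum>i=1..B. if quantile (empirical_cdf B x) \<alpha> \<le> x i then x i else 0)"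
      by (intro sum.cong) auto
    also have "\<dots> = (\<Sum>i\<in>In. x i)"
      unfolding In_def by (rule sum.inter_filter[symmetric]) simp
    finally show ?thesis using B by (simp add: empirical_tail_risk_def)
  qed
  have J: "(\<Sum>i=1..B. of_bool (x i < \<xi>)) = real (card Low)"
    by (simp add: Low_def of_bool_def sum.inter_filter[symmetric])
  have split: "(\<Sum>i=1..B. u i) = (\<Sum>i\<in>In. u i) + (\<Sum>i\<in>Out. u i)"
    unfolding Out_def by (subst sum.subset_diff[of In]) (auto simp: In_def)
  show ?thesis
  proof (cases "Out \<subseteq> Low")
    \<comment> \<open>Included samples at or above \<xi> contribute their own risk; all remaining
      samples make up exactly \<open>Low\<close>.\<close>
    case True
    have "(\<Sum>i\<in>In. u i) = (\<Sum>i\<in>In - Low. u i) + (\<Sum>i\<in>In \<inter> Low. u i)"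
      using fin by (metis add.commute sum.Int_Diff)
    then have "(\<Sum>i=1..B. u i) = (\<Sum>i\<in>In - Low. u i) + ((\<Sum>i\<in>In \<inter> Low. u i) + (\<Sum>i\<in>Out. u i))"
      unfolding split by simp
    also have "(\<Sum>i\<in>In \<inter> Low. u i) + (\<Sum>i\<in>Out. u i) = (\<Sum>i\<in>Low. u i)"
    proof -
      have "Low = (In \<inter> Low) \<union> Out" using True by (auto simp: Out_def Low_def)
      moreover have "(In \<inter> Low) \<inter> Out = {}" by (auto simp: Out_def)
      ultimately show ?thesis using fin by (metis finite_Int sum.union_disjoint)
    qed
    also have "(\<Sum>i\<in>In - Low. u i) = (\<Sum>i\<in>In - Low. x i)"
      using eq by (intro sum.cong) (auto simp: In_def Low_def)
    also have "\<dots> \<le> (\<Sum>i\<in>In. x i)"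
      using fin x by (intro sum_mono2) (auto simp: In_def)
    also have "(\<Sum>i\<in>Low. u i) \<le> real (card Low) * L"
      using u by (intro sum_bounded_above) (auto simp: Low_def)
    also have "real (card Low) * L \<le> L * max (real (card Low)) (\<alpha> * real B)"
      using L by (simp add: mult.commute mult_left_mono)
    finally show ?thesis unfolding A J by simp
  next
    \<comment> \<open>Membership in the estimated tail is monotone in the sample value. As some
      excluded \<open>j\<close> is at or above \<xi>, all included samples are above \<xi>, and only
      \<open>Out\<close> has a cost.\<close>
    case False
    then obtain j where j: "j \<in> Out" "\<xi> \<le> x j" by (auto simp: Out_def Low_def not_less subset_iff)
    have lt: "x k < x i" if "i \<in> In" "k \<in> Out" for i k
    proof (rule ccontr)
      assume "\<not> ?thesis"
      then have "card {l \<in> {1..B}. x l \<le> x i} \<le> card {l \<in> {1..B}. x l \<le> x k}"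
        by (intro card_mono) auto
      then show False using that by (auto simp: Out_def In)
    qed
    have "(\<Sum>i\<in>In. u i) = (\<Sum>i\<in>In. x i)"
    proof (rule sum.cong[OF refl])
      fix i assume "i \<in> In"
      then show "u i = x i" using lt[OF _ j(1), of i] j by (intro eq) (auto simp: In_def)
    qed
    moreover have "(\<Sum>i\<in>Out. u i) \<le> real (card Out) * L"
      using u by (intro sum_bounded_above) (auto simp: Out_def)
    \<comment> \<open>All of \<open>Out\<close> lies at or below its largest value
      \<open>x k\<close>, and since \<open>k\<close> is itself excluded, fewer than
      \<open>\<alpha> * real B\<close> samples do.\<close>
    moreover have "real (card Out) \<le> \<alpha> * real B"
    proof -
      have ne: "x ` Out \<noteq> {}" using j by auto
      obtain k where k: "k \<in> Out" "x k = Max (x ` Out)"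
        using Max_in[OF _ ne] fin by (metis finite_imageI imageE)
      have "Out \<subseteq> {l \<in> {1..B}. x l \<le> x k}" using k fin by (auto simp: Out_def)
      then have "card Out \<le> card {l \<in> {1..B}. x l \<le> x k}" by (intro card_mono) auto
      moreover have "real (card {l \<in> {1..B}. x l \<le> x k}) < \<alpha> * real B"
        using k by (auto simp: Out_def In)
      ultimately show ?thesis by linarith
    qed
    then have "real (card Out) * L \<le> L * max (real (card Low)) (\<alpha> * real B)"
      using L by (simp add: mult.commute mult_left_mono)
    ultimately show ?thesis unfolding A J split by linarith
  qed
qed

text \<open>In the counting form of the tail condition only finite sums and comparisons of
  coordinates remain.\<close>

lemma empirical_tail_risk_measurable [measurable]:
  assumes "\<alpha> \<le> 1"
  shows "empirical_tail_risk \<alpha> B \<in> borel_measurable (PiM {1..B} (\<lambda>_. borel))"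
proof -
  have eq: "empirical_tail_risk \<alpha> B x = (1 / real B) * (\<Sum>i=1..B.
      of_bool (0 \<le> x i \<and> \<alpha> * real B \<le> (\<Sum>k=1..B. of_bool (x k \<le> x i))) * x i)" for x
  proof -
    have "(\<Sum>k=1..B. of_bool (x k \<le> y)) = real (card {k \<in> {1..B}. x k \<le> y})" for y
      by (simp add: of_bool_def sum.inter_filter[symmetric])
    then show ?thesis
      unfolding empirical_tail_risk_def
      by (intro arg_cong2[where f = "(*)"] sum.cong refl)
        (simp only: quantile_empirical_cdf_le_iff[OF assms])
  qed
  show ?thesis
    unfolding eq of_bool_def by measurable
qed

section \<open>Resampling the tail of a law, and laws of independent samples\<close>

text \<open>By \<open>tail\<close>, \<open>\<nu>\<close> acts as the conditional law of
  \<open>\<mu>\<close> on \<open>{\<xi>..}\<close>. Redrawing the tail values of \<open>Y\<close>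
  from it preserves the law: independence yields the product
  \<open>measure \<nu> E * measure \<mu> {\<xi>..}\<close>, which \<open>tail\<close> converts back
  into the tail part of \<open>measure \<mu> E\<close>.\<close>

lemma distr_tail_mixture:
  fixes \<mu> \<nu> :: "real measure"
  assumes P: "prob_space P" and X[measurable]: "X \<in> borel_measurable P" and Y[measurable]: "Y \<in> borel_measurable P"
    and ind: "prob_space.indep_var P borel X borel Y"
    and X_distr: "distr P borel X = \<nu>" and Y_distr: "distr P borel Y = \<mu>"
    and tail: "\<And>E. E \<in> sets borel \<Longrightarrow> measure \<mu> (E \<inter> {\<xi>..}) = measure \<mu> {\<xi>..} * measure \<nu> E"
  shows "distr P borel (\<lambda>\<omega>. if \<xi> \<le> Y \<omega> then X \<omega> else Y \<omega>) = \<mu>"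
proof (rule measure_eqI)
  interpret prob_space P by fact
  show "sets (distr P borel (\<lambda>\<omega>. if \<xi> \<le> Y \<omega> then X \<omega> else Y \<omega>)) = sets \<mu>"
    by (simp flip: Y_distr)
  interpret \<mu>: prob_space \<mu> unfolding Y_distr[symmetric] by (rule prob_space_distr) simp
  have sets\<mu>: "sets \<mu> = sets borel" by (simp flip: Y_distr)
  fix E assume "E \<in> sets (distr P borel (\<lambda>\<omega>. if \<xi> \<le> Y \<omega> then X \<omega> else Y \<omega>))"
  then have E[measurable]: "E \<in> sets borel" by simp
  have mX: "prob (X -` F \<inter> space P) = measure \<nu> F" and mY: "prob (Y -` F \<inter> space P) = measure \<mu> F"
    if "F \<in> sets borel" for F
    using that by (simp_all add: measure_distr flip: X_distr Y_distr)
  have "measure (distr P borel (\<lambda>\<omega>. if \<xi> \<le> Y \<omega> then X \<omega> else Y \<omega>)) E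
      = prob (((\<lambda>\<omega>. if \<xi> \<le> Y \<omega> then X \<omega> else Y \<omega>) -` E) \<inter> space P)"
    by (rule measure_distr) auto
  also have "((\<lambda>\<omega>. if \<xi> \<le> Y \<omega> then X \<omega> else Y \<omega>) -` E) \<inter> space P
      = {\<omega> \<in> space P. X \<omega> \<in> E \<and> Y \<omega> \<in> {\<xi>..}} \<union> (Y -` (E - {\<xi>..}) \<inter> space P)"
    by (auto split: if_splits)
  also have "prob \<dots> = prob {\<omega> \<in> space P. X \<omega> \<in> E \<and> Y \<omega> \<in> {\<xi>..}} + prob (Y -` (E - {\<xi>..}) \<inter> space P)"
    by (rule finite_measure_Union) auto
  also have "prob {\<omega> \<in> space P. X \<omega> \<in> E \<and> Y \<omega> \<in> {\<xi>..}} = measure \<nu> E * measure \<mu> {\<xi>..}"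
  proof -
    have "{\<omega> \<in> space P. X \<omega> \<in> E} = X -` E \<inter> space P"
      "{\<omega> \<in> space P. Y \<omega> \<in> {\<xi>..}} = Y -` {\<xi>..} \<inter> space P" by auto
    then show ?thesis
      using prob_indep_random_variable[OF ind, of E "{\<xi>..}"] E by (simp only: mX mY borel_closed closed_atLeast)
  qed
  also have "prob (Y -` (E - {\<xi>..}) \<inter> space P) = measure \<mu> (E - {\<xi>..})" by (rule mY) simp
  also have "measure \<nu> E * measure \<mu> {\<xi>..} + measure \<mu> (E - {\<xi>..}) = measure \<mu> (E \<inter> {\<xi>..}) + measure \<mu> (E - {\<xi>..})"
    by (simp add: tail)
  also have "\<dots> = measure \<mu> ((E \<inter> {\<xi>..}) \<union> (E - {\<xi>..}))"
    by (rule \<mu>.finite_measure_Union[symmetric]) (auto simp: sets\<mu>)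
  also have "(E \<inter> {\<xi>..}) \<union> (E - {\<xi>..}) = E" by auto
  finally have "measure (distr P borel (\<lambda>\<omega>. if \<xi> \<le> Y \<omega> then X \<omega> else Y \<omega>)) E = measure \<mu> E" .
  note eq = this
  interpret D: prob_space "distr P borel (\<lambda>\<omega>. if \<xi> \<le> Y \<omega> then X \<omega> else Y \<omega>)"
    by (rule prob_space_distr) simp
  show "emeasure (distr P borel (\<lambda>\<omega>. if \<xi> \<le> Y \<omega> then X \<omega> else Y \<omega>)) E = emeasure \<mu> E"
    using eq by (simp add: D.emeasure_eq_measure \<mu>.emeasure_eq_measure)
qed

text \<open>The tuple of all coordinates is the identity of the product space, so its law is the
  product of the marginals.\<close>

lemma indep_vars_PiM_coords:
  assumes "\<And>i. i \<in> I \<Longrightarrow> prob_space (M i)" "I \<noteq> {}"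
  shows "prob_space.indep_vars (PiM I M) M (\<lambda>i \<omega>. \<omega> i) I"
proof -
  interpret prob_space "PiM I M" by (rule prob_space_PiM) fact
  have "distr (PiM I M) (PiM I M) (\<lambda>x. \<lambda>i\<in>I. x i) = PiM I M"
    by (subst distr_cong[OF refl refl, where g = "\<lambda>x. x"])
      (auto simp: space_PiM distr_id2 PiE_restrict)
  also have "\<dots> = PiM I (\<lambda>i. distr (PiM I M) (M i) (\<lambda>\<omega>. \<omega> i))"
    using assms by (intro PiM_cong refl distr_PiM_component[symmetric]) auto
  finally show ?thesis
    using assms by (subst indep_vars_iff_distr_eq_PiM') auto
qed

lemma (in prob_space) distr_PiM_iid:
  assumes ind: "indep_vars (\<lambda>_. N) X I" and "I \<noteq> {}"
    and D: "\<And>i. i \<in> I \<Longrightarrow> distr M N (X i) = D"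
  shows "distr M (PiM I (\<lambda>_. N)) (\<lambda>\<omega>. \<lambda>i\<in>I. X i \<omega>) = PiM I (\<lambda>_. D)"
proof -
  have "random_variable N (X i)" if "i \<in> I" for i
    using ind that by (auto simp: indep_vars_def)
  then have "distr M (PiM I (\<lambda>_. N)) (\<lambda>\<omega>. \<lambda>i\<in>I. X i \<omega>) = PiM I (\<lambda>i. distr M N (X i))"
    using indep_vars_iff_distr_eq_PiM'[where I = I and M' = "\<lambda>_. N" and X = X] ind \<open>I \<noteq> {}\<close> by simp
  also have "\<dots> = PiM I (\<lambda>_. D)" by (intro PiM_cong refl D)
  finally show ?thesis .
qed

section \<open>Concentration of the estimator for laws on the real line\<close>

text \<open>The threshold keeps the Bernoulli variance \<open>\<alpha> * (1 - \<alpha>)\<close> and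
  divides nothing by \<open>1 - \<alpha>\<close>; coarser constants enter only through
  \<open>c\<close>.\<close>

lemma empirical_tail_risk_bound:
  fixes \<mu> \<nu> :: "real measure"
  assumes \<mu>: "prob_space \<mu>" "sets \<mu> = sets borel" and \<nu>: "prob_space \<nu>" "sets \<nu> = sets borel"
    and bnd: "AE x in \<mu>. 0 \<le> x \<and> x \<le> L" and L: "0 < L"
    and tail_mass: "measure \<mu> {\<xi>..} = 1 - \<alpha>"
    and tail: "\<And>E. E \<in> sets borel \<Longrightarrow> measure \<mu> (E \<inter> {\<xi>..}) = (1 - \<alpha>) * measure \<nu> E"
    and \<alpha>: "0 \<le> \<alpha>" "\<alpha> < 1" and B: "1 \<le> B" and t: "0 < t"
    and bound: "\<integral>x. x \<partial>\<nu> - \<alpha> * L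
        - (sqrt (2 * (real B * ((\<integral>x. (x - (\<integral>x. x \<partial>\<nu>))\<^sup>2 \<partial>\<nu>) + \<alpha> * (1 - \<alpha>) * L\<^sup>2)) * t)
           + 2 * L * t / 3) / real B \<ge> c"
  shows "measure (PiM {1..B} (\<lambda>_. \<mu>)) {x \<in> space (PiM {1..B} (\<lambda>_. \<mu>)). empirical_tail_risk \<alpha> B x < c}
           \<le> exp (- t)"
proof -
  define R where "R = (\<integral>x. x \<partial>\<nu>)"
  define V where "V = (\<integral>x. (x - R)\<^sup>2 \<partial>\<nu>)"
  \<comment> \<open>Coordinate \<open>(i, True)\<close> is the tail draw \<open>u i\<close>,
    coordinate \<open>(i, False)\<close> the unrestricted draw \<open>v i\<close>.\<close>
  define N where "N = (\<lambda>(i::nat, b). if b then \<nu> else \<mu>)"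
  define I where "I = {1..B} \<times> (UNIV :: bool set)"
  define P where "P = PiM I N"
  define s where "s = sqrt (2 * (real B * (V + \<alpha> * (1 - \<alpha>) * L\<^sup>2)) * t) + 2 * L * t / 3"
  interpret \<mu>: prob_space \<mu> by fact
  interpret \<nu>: prob_space \<nu> by fact
  note sets_eq[measurable_cong] = \<mu>(2) \<nu>(2)
  have N: "prob_space (N k)" "sets (N k) = sets borel" for k
    using \<mu> \<nu> by (auto simp: N_def split: prod.splits)
  have N_True: "N k = \<nu>" if "snd k" for k using that by (cases k) (simp add: N_def)
  have N_False: "N k = \<mu>" if "\<not> snd k" for k using that by (cases k) (simp add: N_def)
  interpret P: prob_space P unfolding P_def by (rule prob_space_PiM) (rule N)
  have coord[measurable]: "(\<lambda>\<omega>. \<omega> k) \<in> borel_measurable P" if "k \<in> I" for k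
    using measurable_component_singleton[OF that, of N] unfolding P_def measurable_cong_sets[OF refl N(2)] .
  have I_ne: "I \<noteq> {}" and I_fin: "finite I" using B by (auto simp: I_def)
  have "P.indep_vars N (\<lambda>k \<omega>. \<omega> k) I"
    unfolding P_def by (intro indep_vars_PiM_coords N I_ne)
  then have ind: "P.indep_vars (\<lambda>_. borel) (\<lambda>k \<omega>. \<omega> k) I"
    by (subst P.indep_vars_compose2[where M' = N and Y = "\<lambda>_ x. x"]) (auto intro!: measurable_ident_sets N)
  have D: "distr P borel (\<lambda>\<omega>. \<omega> k) = N k" if "k \<in> I" for k
    using distr_PiM_component[of I N k] that N by (metis (no_types, lifting) P_def distr_cong)

  have "measure \<nu> {..<\<xi>} = 0"
  proof -
    have "{..<\<xi>} \<inter> {\<xi>..} = {}" by auto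
    then show ?thesis using tail[of "{..<\<xi>}"] \<alpha> by simp
  qed
  then have ge_\<xi>: "AE x in \<nu>. \<xi> \<le> x"
    using sets_eq by (subst (asm) \<nu>.prob_eq_0) (auto elim!: eventually_mono)
  \<comment> \<open>Values outside \<open>{0..L}\<close> are null for \<open>\<mu>\<close>, and
    \<open>tail\<close> passes null sets on to \<open>\<nu>\<close> because
    \<open>1 - \<alpha>\<close> is positive.\<close>
  have bnd\<nu>: "AE x in \<nu>. 0 \<le> x \<and> x \<le> L"
  proof -
    have "measure \<mu> ((- {0..L}) \<inter> {\<xi>..}) = 0"
    proof -
      have "measure \<mu> (- {0..L}) = 0"
        using bnd sets_eq by (subst \<mu>.prob_eq_0) (auto elim!: eventually_mono)
      then show ?thesis using sets_eq
        by (metis \<mu>.finite_measure_mono inf_le1 measure_nonneg order_antisym borel_comp closed_atLeastAtMost borel_closed)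
    qed
    then have "measure \<nu> (- {0..L}) = 0" using tail[of "- {0..L}"] \<alpha> by simp
    then show ?thesis using sets_eq by (subst (asm) \<nu>.prob_eq_0) (auto elim!: eventually_mono)
  qed
  have AE_coord: "AE \<omega> in P. Q (\<omega> k)" if "k \<in> I" "AE x in N k. Q x" for k Q
    unfolding P_def by (rule AE_PiM_component) (use that N in auto)
  have int\<nu>: "integrable \<nu> (\<lambda>x. x)"
    by (rule \<nu>.integrable_AE_bounded[of _ L])
      (simp add: measurable_ident_sets sets_eq, use bnd\<nu> in eventually_elim, auto)
  have "AE x in \<nu>. 0 \<le> x" "AE x in \<nu>. x \<le> L" using bnd\<nu> by (auto elim: eventually_mono)
  then have R: "0 \<le> R" "R \<le> L"
    using \<nu>.integral_le_const[OF int\<nu>] \<nu>.integral_ge_const[OF int\<nu>] by (auto simp: R_def)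

  \<comment> \<open>The \<open>True\<close> summands add up to \<open>G\<close>, the
    \<open>False\<close> summands to \<open>H\<close>.\<close>
  define Z where "Z = (\<lambda>(k::nat \<times> bool) \<omega>. if snd k then R - \<omega> k else L * (of_bool (\<omega> k < \<xi>) - \<alpha>) :: real)"
  define v where "v = (\<lambda>k::nat \<times> bool. if snd k then V else \<alpha> * (1 - \<alpha>) * L\<^sup>2)"
  let ?T = "{1..B} \<times> {True}" and ?F = "{1..B} \<times> {False}"
  have TF: "?T \<union> ?F = I" by (auto simp: I_def)
  have row_sum: "(\<Sum>k\<in>{1..B} \<times> {b}. f k) = (\<Sum>i=1..B. f (i, b))" for b and f :: "nat \<times> bool \<Rightarrow> real"
    by (rule sum.reindex_bij_witness[of _ "\<lambda>i. (i, b)" fst]) auto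
  have Z_ind: "P.indep_vars (\<lambda>_. borel) Z I"
    using P.indep_vars_compose2[OF ind, of "\<lambda>k x. if snd k then R - x else L * (of_bool (x < \<xi>) - \<alpha>)" "\<lambda>_. borel"]
    unfolding Z_def of_bool_def by simp
  have low: "measure \<mu> {..<\<xi>} = \<alpha>"
    using \<mu>.prob_compl[of "{\<xi>..}"] tail_mass sets_eq by (simp add: sets_eq_imp_space_eq[OF \<mu>(2)] Compl_atLeast flip: Compl_eq_Diff_UNIV)
  have Elow: "(\<integral>x. of_bool (x < \<xi>) \<partial>\<mu>) = \<alpha>"
  proof -
    have "(\<integral>x. of_bool (x < \<xi>) \<partial>\<mu>) = (\<integral>x. indicator {..<\<xi>} x \<partial>\<mu>)"
      by (intro Bochner_Integration.integral_cong) (auto simp: indicator_def)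
    also have "\<dots> = \<alpha>" using low by (simp add: sets_eq_imp_space_eq[OF \<mu>(2)])
    finally show ?thesis .
  qed
  have int_low: "integrable \<mu> (\<lambda>x. of_bool (x < \<xi>) :: real)"
    unfolding of_bool_def by (intro \<mu>.integrable_AE_bounded[of _ 1]) auto
  have tr: "P.expectation (\<lambda>\<omega>. g (\<omega> k)) = (\<integral>x. g x \<partial>N k)"
    if "k \<in> I" "g \<in> borel_measurable borel" for k and g :: "real \<Rightarrow> real"
    using integral_distr[OF coord[OF that(1)] that(2)] D[OF that(1)] by simp
  have Z_bnd: "AE \<omega> in P. \<bar>Z k \<omega>\<bar> \<le> L" if k: "k \<in> I" for k
  proof (cases "snd k")
    case True
    then have "AE x in N k. 0 \<le> x \<and> x \<le> L" using bnd\<nu> by (simp only: N_True)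
    from AE_coord[OF k this] show ?thesis
      by eventually_elim (use R True in \<open>auto simp: Z_def\<close>)
  next
    case False
    have "\<bar>L * (of_bool b - \<alpha>)\<bar> \<le> L * 1" for b
      unfolding abs_mult using L \<alpha> by (intro mult_mono) auto
    then show ?thesis using False by (simp add: Z_def)
  qed
  have Z_mean: "P.expectation (Z k) = 0" if k: "k \<in> I" for k
  proof (cases "snd k")
    case True
    then have "P.expectation (Z k) = (\<integral>x. R - x \<partial>N k)" by (simp add: Z_def tr[OF k, symmetric])
    also have "N k = \<nu>" using True by (rule N_True)
    finally show ?thesis using int\<nu> by (simp add: R_def \<nu>.prob_space)
  next
    case False
    then have "P.expectation (Z k) = (\<integral>x. L * (of_bool (x < \<xi>) - \<alpha>) \<partial>N k)"
      by (subst tr[OF k, symmetric]) (auto simp: Z_def of_bool_def)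
    also have "N k = \<mu>" using False by (rule N_False)
    finally show ?thesis using int_low Elow by (simp add: \<mu>.prob_space)
  qed
  have Z_var: "P.expectation (\<lambda>\<omega>. (Z k \<omega>)\<^sup>2) \<le> v k" if k: "k \<in> I" for k
  proof (cases "snd k")
    case True
    then have "P.expectation (\<lambda>\<omega>. (Z k \<omega>)\<^sup>2) = (\<integral>x. (R - x)\<^sup>2 \<partial>N k)" by (simp add: Z_def tr[OF k, symmetric])
    also have "N k = \<nu>" using True by (rule N_True)
    finally show ?thesis using True by (simp add: v_def V_def power2_commute)
  next
    case False
    then have "P.expectation (\<lambda>\<omega>. (Z k \<omega>)\<^sup>2) = (\<integral>x. (L * (of_bool (x < \<xi>) - \<alpha>))\<^sup>2 \<partial>N k)"
      by (subst tr[OF k, symmetric]) (auto simp: Z_def of_bool_def)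
    also have "N k = \<mu>" using False by (rule N_False)
    \<comment> \<open>An indicator equals its square, so the integrand is affine in
      \<open>of_bool (x < \<xi>)\<close> and its integral needs only the mass \<alpha> below
      \<xi>.\<close>
    also have "(\<integral>x. (L * (of_bool (x < \<xi>) - \<alpha>))\<^sup>2 \<partial>\<mu>)
        = (\<integral>x. L\<^sup>2 * ((1 - 2 * \<alpha>) * of_bool (x < \<xi>) + \<alpha>\<^sup>2) \<partial>\<mu>)"
      by (intro Bochner_Integration.integral_cong)
        (auto simp: of_bool_def power2_eq_square algebra_simps)
    also have "\<dots> = L\<^sup>2 * ((1 - 2 * \<alpha>) * \<alpha> + \<alpha>\<^sup>2)"
      using int_low Elow by (simp add: \<mu>.prob_space)
    finally show ?thesis using False by (simp add: v_def power2_eq_square algebra_simps)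
  qed
  have v_sum: "(\<Sum>k\<in>?T \<union> ?F. v k) \<le> real B * (V + \<alpha> * (1 - \<alpha>) * L\<^sup>2)"
  proof -
    have "(\<Sum>k\<in>?T \<union> ?F. v k) = (\<Sum>k\<in>?T. v k) + (\<Sum>k\<in>?F. v k)"
      by (rule sum.union_disjoint) auto
    then show ?thesis unfolding row_sum by (simp add: v_def algebra_simps)
  qed
  have tail_prob: "P.prob {\<omega> \<in> space P. s \<le> (\<Sum>k\<in>?T. Z k \<omega>) + max 0 (\<Sum>k\<in>?F. Z k \<omega>)} \<le> exp (- t)"
    by (rule P.Bernstein_add_pos_part[where I = ?T and J = ?F and Z = Z and b = L and v = v
          and V = "real B * (V + \<alpha> * (1 - \<alpha>) * L\<^sup>2)", unfolded TF])
      (use Z_ind Z_bnd Z_mean Z_var L t v_sum[unfolded TF] in \<open>auto simp: s_def\<close>)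

  \<comment> \<open>The sample \<open>x i\<close>, rebuilt so that its tail value is independent of
    whether it falls into the tail.\<close>
  define W where "W = (\<lambda>i \<omega>. if \<xi> \<le> \<omega> (i, False) then \<omega> (i, True) else \<omega> (i::nat, False) :: real)"
  have W_meas[measurable]: "W i \<in> borel_measurable P" if "i \<in> {1..B}" for i
    using that unfolding W_def by (auto simp: I_def)
  have W_distr: "distr P borel (W i) = \<mu>" if i: "i \<in> {1..B}" for i
    unfolding W_def
  proof (rule distr_tail_mixture[where \<nu> = \<nu>])
    have mem: "(i, True) \<in> I" "(i, False) \<in> I" using i by (auto simp: I_def)
    have "P.indep_var borel ((\<lambda>f. f (i, True)) \<circ> (\<lambda>\<omega>. restrict (\<lambda>k. \<omega> k) {(i, True)}))
        borel ((\<lambda>f. f (i, False)) \<circ> (\<lambda>\<omega>. restrict (\<lambda>k. \<omega> k) {(i, False)}))"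
      using mem by (intro P.indep_var_compose[OF P.indep_var_restrict[OF ind]]) auto
    then show "P.indep_var borel (\<lambda>\<omega>. \<omega> (i, True)) borel (\<lambda>\<omega>. \<omega> (i, False))"
      by (simp add: comp_def)
    show "distr P borel (\<lambda>\<omega>. \<omega> (i, True)) = \<nu>" "distr P borel (\<lambda>\<omega>. \<omega> (i, False)) = \<mu>"
      using D mem by (auto simp: N_def)
  qed (use i tail tail_mass P.prob_space_axioms in \<open>auto simp: I_def\<close>)
  \<comment> \<open>Each \<open>W i\<close> reads only the block \<open>{i} \<times> UNIV\<close>,
    and these blocks are disjoint.\<close>
  have W_ind: "P.indep_vars (\<lambda>_. borel) W {1..B}"
  proof -
    have "P.indep_vars (\<lambda>i. PiM ({i} \<times> UNIV) (\<lambda>_. borel)) (\<lambda>i \<omega>. restrict (\<lambda>k. \<omega> k) ({i} \<times> UNIV)) {1..B}"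
      by (rule P.indep_vars_restrict[OF ind]) (auto simp: I_def disjoint_family_on_def)
    then have "P.indep_vars (\<lambda>_. borel) (\<lambda>i \<omega>. W i (restrict (\<lambda>k. \<omega> k) ({i} \<times> UNIV))) {1..B}"
      by (rule P.indep_vars_compose2) (simp add: W_def)
    then show ?thesis by (simp add: W_def cong: if_cong)
  qed
  have W_PiM: "distr P (PiM {1..B} (\<lambda>_. borel)) (\<lambda>\<omega>. \<lambda>i\<in>{1..B}. W i \<omega>) = PiM {1..B} (\<lambda>_. \<mu>)"
    using B by (intro P.distr_PiM_iid W_ind W_distr) auto

  have sets_PiM: "sets (PiM {1..B} (\<lambda>_. \<mu>)) = sets (PiM {1..B} (\<lambda>_. borel))"
    by (rule sets_PiM_cong) (auto simp: sets_eq)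
  have [measurable]: "empirical_tail_risk \<alpha> B \<in> borel_measurable (PiM {1..B} (\<lambda>_. borel))"
    using \<alpha> by (intro empirical_tail_risk_measurable) simp
  let ?A = "{x \<in> space (PiM {1..B} (\<lambda>_. borel)). empirical_tail_risk \<alpha> B x < c}"
  have A: "?A \<in> sets (PiM {1..B} (\<lambda>_. borel))" by measurable
  have "measure (PiM {1..B} (\<lambda>_. \<mu>)) {x \<in> space (PiM {1..B} (\<lambda>_. \<mu>)). empirical_tail_risk \<alpha> B x < c}
      = measure (distr P (PiM {1..B} (\<lambda>_. borel)) (\<lambda>\<omega>. \<lambda>i\<in>{1..B}. W i \<omega>)) ?A"
    unfolding W_PiM sets_eq_imp_space_eq[OF sets_PiM] ..
  also have "\<dots> = P.prob ((\<lambda>\<omega>. \<lambda>i\<in>{1..B}. W i \<omega>) -` ?A \<inter> space P)"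
    by (rule measure_distr[OF _ A]) (intro measurable_restrict W_meas)
  \<comment> \<open>The inclusion of events holds only almost surely, as do the bounds on the
    coordinates and \<open>\<xi> \<le> \<omega> (i, True)\<close>.\<close>
  also have "\<dots> \<le> P.prob {\<omega> \<in> space P. s \<le> (\<Sum>k\<in>?T. Z k \<omega>) + max 0 (\<Sum>k\<in>?F. Z k \<omega>)}"
  proof (rule P.finite_measure_mono_AE)
    have bnd_N: "AE x in N k. 0 \<le> x \<and> x \<le> L" for k
      using bnd bnd\<nu> N_True[of k] N_False[of k] by (cases "snd k") (simp_all only: simp_thms)
    have ge_N: "AE x in N k. snd k \<longrightarrow> \<xi> \<le> x" for k
    proof (cases "snd k")
      case True
      show ?thesis unfolding N_True[OF True] using ge_\<xi> by simp
    qed simp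
    have "AE \<omega> in P. \<forall>k\<in>I. 0 \<le> \<omega> k \<and> \<omega> k \<le> L"
      using I_fin bnd_N by (intro AE_finite_allI AE_coord)
    moreover have "AE \<omega> in P. \<forall>k\<in>I. snd k \<longrightarrow> \<xi> \<le> \<omega> k"
      using I_fin ge_N by (intro AE_finite_allI AE_coord)
    ultimately show "AE \<omega> in P. \<omega> \<in> (\<lambda>\<omega>. \<lambda>i\<in>{1..B}. W i \<omega>) -` ?A \<inter> space P \<longrightarrow>
        \<omega> \<in> {\<omega> \<in> space P. s \<le> (\<Sum>k\<in>?T. Z k \<omega>) + max 0 (\<Sum>k\<in>?F. Z k \<omega>)}"
    proof eventually_elim
      case (elim \<omega>)
      show ?case
      proof
        assume "\<omega> \<in> (\<lambda>\<omega>. \<lambda>i\<in>{1..B}. W i \<omega>) -` ?A \<inter> space P"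
        then have sp: "\<omega> \<in> space P" and less: "empirical_tail_risk \<alpha> B (\<lambda>i\<in>{1..B}. W i \<omega>) < c" by auto
        define J where "J = (\<Sum>i=1..B. of_bool (\<omega> (i, False) < \<xi>) :: real)"
        define A where "A = real B * empirical_tail_risk \<alpha> B (\<lambda>i\<in>{1..B}. W i \<omega>)"
        have mem: "(i, b) \<in> I" if "i \<in> {1..B}" for i b using that by (simp add: I_def)
        have \<omega>: "0 \<le> \<omega> (i, b)" "\<omega> (i, b) \<le> L" "\<xi> \<le> \<omega> (i, True)" if "i \<in> {1..B}" for i b
          using elim mem[OF that] by auto
        have "(\<Sum>i=1..B. \<omega> (i, True)) \<le> A
            + L * max (\<Sum>i=1..B. of_bool ((\<lambda>i\<in>{1..B}. W i \<omega>) i < \<xi>)) (\<alpha> * real B)"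
          unfolding A_def using \<alpha> B L \<omega>
          by (intro sum_le_empirical_tail_risk) (auto simp: W_def split: if_splits)
        \<comment> \<open>Tail draws are at least \<xi>, so a rebuilt sample is below \<xi> exactly
          when its unrestricted draw is. Hence the count depends on the \<open>False\<close>
          coordinates alone.\<close>
        also have "(\<Sum>i=1..B. of_bool ((\<lambda>i\<in>{1..B}. W i \<omega>) i < \<xi>)) = J"
          unfolding J_def
        proof (rule sum.cong[OF refl])
          fix i assume "i \<in> {1..B}"
          then show "of_bool ((\<lambda>i\<in>{1..B}. W i \<omega>) i < \<xi>) = (of_bool (\<omega> (i, False) < \<xi>) :: real)"
            using \<omega>(3)[of i] by (auto simp: W_def)
        qed
        finally have 1: "(\<Sum>i=1..B. \<omega> (i, True)) \<le> A + L * max J (\<alpha> * real B)" .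
        have "empirical_tail_risk \<alpha> B (\<lambda>i\<in>{1..B}. W i \<omega>) \<le> R - \<alpha> * L - s / real B"
          using less bound by (simp add: R_def V_def s_def)
        then have "A \<le> real B * (R - \<alpha> * L - s / real B)"
          unfolding A_def by (intro mult_left_mono) auto
        then have 2: "A \<le> real B * R - L * (\<alpha> * real B) - s"
          using B by (simp add: algebra_simps)
        \<comment> \<open>The larger of the two counts becomes the positive part of
          \<open>H\<close>; the remainder \<open>L * (\<alpha> * real B)\<close> cancels against the
          term \<open>\<alpha> * L\<close> in \<open>bound\<close>.\<close>
        have 3: "L * max J (\<alpha> * real B) = max 0 (L * (J - \<alpha> * real B)) + L * (\<alpha> * real B)"
          using L by (simp add: max_def algebra_simps)
        have "(\<Sum>i=1..B. Z (i, True) \<omega>) = real B * R - (\<Sum>i=1..B. \<omega> (i, True))"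
          by (simp add: Z_def sum_subtractf)
        moreover have "(\<Sum>i=1..B. Z (i, False) \<omega>) = L * (J - \<alpha> * real B)"
          by (simp add: Z_def sum_subtractf J_def mult.commute flip: sum_distrib_left)
        ultimately show "\<omega> \<in> {\<omega> \<in> space P. s \<le> (\<Sum>k\<in>?T. Z k \<omega>) + max 0 (\<Sum>k\<in>?F. Z k \<omega>)}"
          unfolding row_sum using sp 1 2 3 by simp
      qed
    qed
    show "{\<omega> \<in> space P. s \<le> (\<Sum>k\<in>?T. Z k \<omega>) + max 0 (\<Sum>k\<in>?F. Z k \<omega>)} \<in> P.events"
      using Z_ind by (auto simp: P.indep_vars_def TF[symmetric] intro!: borel_measurable_le borel_measurable_add borel_measurable_max borel_measurable_sum)
  qed
  also note tail_prob
  finally show ?thesis .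
qed

text \<open>Points of the product space are \<open>undefined\<close> outside \<open>{1..B}\<close>,
  whereas the final statement feeds in a function on all indices.\<close>

lemma empirical_tail_risk_cong:
  assumes "\<And>i. i \<in> {1..B} \<Longrightarrow> x i = y i"
  shows "empirical_tail_risk \<alpha> B x = empirical_tail_risk \<alpha> B y"
proof -
  have "empirical_cdf B x = empirical_cdf B y"
    unfolding empirical_cdf_def using assms by (metis (no_types, lifting) Collect_cong)
  then show ?thesis
    unfolding empirical_tail_risk_def using assms by (intro arg_cong2[where f = "(*)"] sum.cong) auto
qed

section \<open>The quantile and the tail law of the risk\<close>

text \<open>A Lipschitz distribution function excludes atoms, so the level \<alpha> is attained
  exactly. The second claim later forces \<open>Lmax\<close> to be positive.\<close>

lemma tail_measure_quantile:
  fixes \<mu> :: "real measure"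
  assumes \<mu>: "prob_space \<mu>" "sets \<mu> = sets borel"
    and nonneg: "AE x in \<mu>. 0 \<le> x"
    and lip: "K-lipschitz_on UNIV (\<lambda>x. measure \<mu> {..x})"
    and \<alpha>: "0 \<le> \<alpha>" "\<alpha> < 1"
  defines "\<xi> \<equiv> quantile (\<lambda>x. measure \<mu> {..x}) \<alpha>"
  shows "measure \<mu> {\<xi>..} = 1 - \<alpha>" and "measure \<mu> {..0} = 0"
proof -
  interpret prob_space \<mu> by fact
  note sets_eq[measurable_cong] = \<mu>(2)
  have sp: "space \<mu> = UNIV" using sets_eq_imp_space_eq[OF \<mu>(2)] by simp
  define F where "F = (\<lambda>x. measure \<mu> {..x})"
  have K: "0 \<le> K" using lip by (rule lipschitz_on_nonneg)
  have F_le: "F y \<le> F x + K * h" if "y \<le> x + h" "x \<le> y" for x y h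
  proof -
    have "F y - F x \<le> K * (y - x)"
      using lipschitz_onD[OF lip, of y x] that by (simp add: F_def dist_real_def)
    also have "\<dots> \<le> K * h" using that K by (intro mult_left_mono) auto
    finally show ?thesis by simp
  qed
  \<comment> \<open>Bounds valid just to the left of \<open>y\<close> extend to \<open>y\<close> by
    continuity. Dividing by \<open>K + 1\<close> covers the case \<open>K = 0\<close>.\<close>
  have F_le_lim: "F y \<le> a" if "\<And>h. 0 < h \<Longrightarrow> h \<le> h0 \<Longrightarrow> F (y - h) \<le> a" "0 < h0" for y a h0
  proof (rule field_le_epsilon)
    fix e :: real assume e: "0 < e"
    define h where "h = min h0 (e / (K + 1))"
    have h: "0 < h" "h \<le> h0" "h \<le> e / (K + 1)" using that(2) e K by (auto simp: h_def)
    have "K * h \<le> (K + 1) * h" using h by (simp add: algebra_simps)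
    also have "\<dots> \<le> e" using h(3) K by (simp add: field_simps)
    finally show "F y \<le> a + e" using F_le[of y "y - h" h] that(1)[OF h(1,2)] h by simp
  qed
  have no_atom: "measure \<mu> {..<y} = F y" for y
  proof (rule antisym)
    show "measure \<mu> {..<y} \<le> F y" unfolding F_def by (intro finite_measure_mono) auto
    show "F y \<le> measure \<mu> {..<y}"
      unfolding F_def by (rule F_le_lim[unfolded F_def, of 1]) (auto intro!: finite_measure_mono)
  qed
  have "measure \<mu> {..<0} = 0"
    using nonneg by (subst prob_eq_0) (auto elim!: eventually_mono)
  then have F0: "F 0 = 0" by (simp add: no_atom)
  then show "measure \<mu> {..0} = 0" by (simp add: F_def)
  define S where "S = {x. 0 \<le> x \<and> \<alpha> \<le> F x}"
  have \<xi>: "\<xi> = Inf S" by (simp add: \<xi>_def quantile_def S_def F_def)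
  have bdd: "bdd_below S" by (auto simp: S_def)
  \<comment> \<open>The distribution function tends to 1, which exceeds \<alpha>.\<close>
  have ne: "S \<noteq> {}"
  proof -
    interpret real_distribution \<mu> by unfold_locales (use \<mu> sp in auto)
    have "eventually (\<lambda>x. \<alpha> < F x) at_top"
      using order_tendstoD(1)[OF cdf_lim_at_top_prob \<alpha>(2)] by (simp add: F_def cdf_def)
    then have "eventually (\<lambda>x. x \<in> S) at_top"
      using eventually_ge_at_top[of 0] by eventually_elim (simp add: S_def)
    then show ?thesis by (auto simp: eventually_at_top_linorder)
  qed
  \<comment> \<open>Closedness puts the infimum itself into \<open>S\<close>, which yields
    \<open>\<alpha> \<le> F \<xi>\<close>.\<close>
  have "closed S"
    unfolding S_def using lipschitz_on_continuous_on[OF lip]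
    by (intro closed_Collect_conj closed_Collect_le) (auto simp: F_def)
  then have "\<xi> \<in> S" unfolding \<xi> using ne bdd by (intro closed_contains_Inf)
  then have \<xi>0: "0 \<le> \<xi>" and ge: "\<alpha> \<le> F \<xi>" by (auto simp: S_def)
  \<comment> \<open>Nonnegative levels below \<xi> are not in \<open>S\<close>, and the bound passes
    to the limit from the left. For \<open>\<xi> = 0\<close> there are no such levels, and
    \<open>F 0 = 0\<close> decides.\<close>
  have "F \<xi> \<le> \<alpha>"
  proof (cases "\<xi> = 0")
    case False
    then have pos: "0 < \<xi>" using \<xi>0 by simp
    show ?thesis
    proof (rule F_le_lim[OF _ pos])
      fix h assume "0 < h" "h \<le> \<xi>"
      then have "\<xi> - h \<notin> S" using cInf_lower[OF _ bdd, of "\<xi> - h"] by (auto simp: \<xi>)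
      then show "F (\<xi> - h) \<le> \<alpha>" using \<open>h \<le> \<xi>\<close> by (simp add: S_def)
    qed
  qed (simp add: F0 \<alpha>)
  with ge have "measure \<mu> {..<\<xi>} = \<alpha>" by (simp add: no_atom)
  moreover have "space \<mu> - {..<\<xi>} = {\<xi>..}" by (auto simp: sp)
  ultimately show "measure \<mu> {\<xi>..} = 1 - \<alpha>"
    using prob_compl[of "{..<\<xi>}"] by simp
qed

lemma emeasure_tail_measure:
  assumes p[measurable]: "p \<in> borel_measurable N" and p_nonneg: "\<And>\<tau>. \<tau> \<in> space N \<Longrightarrow> 0 \<le> p \<tau>"
    and r[measurable]: "(\<lambda>\<tau>. r \<tau> \<theta>) \<in> borel_measurable N" and \<alpha>: "\<alpha> < 1" and A[measurable]: "A \<in> sets N"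
  shows "emeasure (tail_measure N p r \<alpha> \<theta>) A
    = ennreal (1 / (1 - \<alpha>)) * emeasure (density N (\<lambda>\<tau>. ennreal (p \<tau>))) (A \<inter> tail_region N p r \<alpha> \<theta>)"
proof -
  have C[measurable]: "tail_region N p r \<alpha> \<theta> \<in> sets N"
    unfolding tail_region_def by measurable
  have [measurable]: "(\<lambda>\<tau>. tail_density N p r \<alpha> \<tau> \<theta>) \<in> borel_measurable N"
    unfolding tail_density_def by measurable
  have "emeasure (tail_measure N p r \<alpha> \<theta>) A
      = (\<integral>\<^sup>+\<tau>. ennreal (tail_density N p r \<alpha> \<tau> \<theta>) * indicator A \<tau> \<partial>N)"
    unfolding tail_measure_def by (rule emeasure_density) auto
  also have "\<dots> = (\<integral>\<^sup>+\<tau>. ennreal (1 / (1 - \<alpha>)) * (ennreal (p \<tau>) * indicator (A \<inter> tail_region N p r \<alpha> \<theta>) \<tau>) \<partial>N)"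
    using p_nonneg \<alpha>
    by (intro nn_integral_cong) (auto simp: tail_density_def indicator_def ennreal_mult[symmetric])
  also have "\<dots> = ennreal (1 / (1 - \<alpha>)) * (\<integral>\<^sup>+\<tau>. ennreal (p \<tau>) * indicator (A \<inter> tail_region N p r \<alpha> \<theta>) \<tau> \<partial>N)"
    by (rule nn_integral_cmult) auto
  also have "(\<integral>\<^sup>+\<tau>. ennreal (p \<tau>) * indicator (A \<inter> tail_region N p r \<alpha> \<theta>) \<tau> \<partial>N)
      = emeasure (density N (\<lambda>\<tau>. ennreal (p \<tau>))) (A \<inter> tail_region N p r \<alpha> \<theta>)"
    by (rule emeasure_density[symmetric]) auto
  finally show ?thesis .
qed

text \<open>As \<open>0 < 1 - \<alpha> \<le> 1\<close>, dividing a nonnegative term by it only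
  enlarges the term. This is applied to the variance weight and to the linear terms, where
  \<open>\<alpha> * L\<close> becomes the summand with \<open>3 * \<alpha> * B\<close>.\<close>

lemma tail_bound_arith:
  fixes L V \<alpha> t R B :: real
  assumes "0 < L" "0 \<le> V" "0 \<le> \<alpha>" "\<alpha> < 1" "0 < t" "1 \<le> B"
  shows "R - (sqrt (2 * (\<alpha> / (1 - \<alpha>) * L\<^sup>2 + V) * t / B)
        + 1 / (3 * (1 - \<alpha>)) * (L / B) * (2 * t + 3 * \<alpha> * B))
      \<le> R - \<alpha> * L - (sqrt (2 * (B * (V + \<alpha> * (1 - \<alpha>) * L\<^sup>2)) * t) + 2 * L * t / 3) / B"
proof -
  have le_div: "x \<le> x / (1 - \<alpha>)" if "0 \<le> x" for x
    using that assms mult_left_mono[of "1 - \<alpha>" 1 x] by (simp add: pos_le_divide_eq)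
  have "sqrt (2 * (B * (V + \<alpha> * (1 - \<alpha>) * L\<^sup>2)) * t) / B
      = sqrt (2 * (V + \<alpha> * (1 - \<alpha>) * L\<^sup>2) * t / B)"
  proof -
    have "2 * (V + \<alpha> * (1 - \<alpha>) * L\<^sup>2) * t / B = 2 * (B * (V + \<alpha> * (1 - \<alpha>) * L\<^sup>2)) * t / B\<^sup>2"
      using assms by (simp add: power2_eq_square)
    then show ?thesis using assms by (simp add: real_sqrt_divide)
  qed
  also have "\<dots> \<le> sqrt (2 * (\<alpha> / (1 - \<alpha>) * L\<^sup>2 + V) * t / B)"
  proof -
    have "\<alpha> * (1 - \<alpha>) \<le> \<alpha> * 1" using assms by (intro mult_left_mono) auto
    also have "\<dots> \<le> \<alpha> / (1 - \<alpha>)" using le_div[of \<alpha>] assms by simp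
    finally have "\<alpha> * (1 - \<alpha>) * L\<^sup>2 \<le> \<alpha> / (1 - \<alpha>) * L\<^sup>2" by (rule mult_right_mono) simp
    then show ?thesis
      using assms by (intro real_sqrt_le_mono divide_right_mono mult_right_mono mult_left_mono) auto
  qed
  finally have 1: "sqrt (2 * (B * (V + \<alpha> * (1 - \<alpha>) * L\<^sup>2)) * t) / B
      \<le> sqrt (2 * (\<alpha> / (1 - \<alpha>) * L\<^sup>2 + V) * t / B)" .
  have "2 * L * t / 3 / B + \<alpha> * L \<le> (2 * L * t / 3 / B + \<alpha> * L) / (1 - \<alpha>)"
    using assms by (intro le_div) auto
  also have "\<dots> = 1 / (3 * (1 - \<alpha>)) * (L / B) * (2 * t + 3 * \<alpha> * B)"
    using assms by (simp add: field_simps)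
  finally show ?thesis using 1 by (simp add: add_divide_distrib)
qed

section \<open>The generalization bound for task samples\<close>

theorem theorem4p3:
  fixes N :: "'t measure" and p :: "'t \<Rightarrow> real"
    and Q S :: "'t \<Rightarrow> 'd" and l :: "'d \<Rightarrow> 'd \<Rightarrow> 'p::metric_space \<Rightarrow> real"
    and r :: "'t \<Rightarrow> 'p \<Rightarrow> real"
    and \<Theta> :: "'p set" and \<theta>s :: 'p
    and \<alpha> \<epsilon> Lmax \<beta>\<^sub>l \<beta>\<^sub>\<theta> :: real and \<beta> :: "'t \<Rightarrow> real"
    and B :: nat
    and M :: "'w measure" and T :: "nat \<Rightarrow> 'w \<Rightarrow> 't"
  assumes p_measurable: "p \<in> borel_measurable N"
    and p_nonneg: "\<And>\<tau>. \<tau> \<in> space N \<Longrightarrow> 0 \<le> p \<tau>"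
    and p_prob: "prob_space (density N (\<lambda>\<tau>. ennreal (p \<tau>)))"
    and r_eq: "\<And>\<tau> \<theta>. r \<tau> \<theta> = l (Q \<tau>) (S \<tau>) \<theta>"
    and r_measurable: "\<And>\<theta>. \<theta> \<in> \<Theta> \<Longrightarrow> (\<lambda>\<tau>. r \<tau> \<theta>) \<in> borel_measurable N"
    and r_nonneg: "\<And>\<tau> \<theta>. \<tau> \<in> space N \<Longrightarrow> \<theta> \<in> \<Theta> \<Longrightarrow> 0 \<le> r \<tau> \<theta>"
    and \<theta>_mem: "\<theta>s \<in> \<Theta>"
    and \<alpha>_range: "0 \<le> \<alpha>" "\<alpha> < 1"
    and \<epsilon>_range: "0 < \<epsilon>" "\<epsilon> < 1"
    and B_pos: "1 \<le> B"
    and r_lipschitz: "\<And>\<tau>. \<tau> \<in> space N \<Longrightarrow> (\<beta> \<tau>)-lipschitz_on \<Theta> (\<lambda>\<theta>. r \<tau> \<theta>)"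
    and cdf_lipschitz: "\<And>\<theta>. \<theta> \<in> \<Theta> \<Longrightarrow> \<beta>\<^sub>l-lipschitz_on UNIV (risk_cdf N p r \<theta>)"
    and tail_density_lipschitz:
      "\<And>\<tau>. \<tau> \<in> space N \<Longrightarrow> \<beta>\<^sub>\<theta>-lipschitz_on \<Theta> (\<lambda>\<theta>. tail_density N p r \<alpha> \<tau> \<theta>)"
    and tail_bound:
      "\<And>\<theta>. \<theta> \<in> \<Theta> \<Longrightarrow> (SUP \<tau>\<in>tail_region N p r \<alpha> \<theta>. ereal (r \<tau> \<theta>)) \<le> ereal Lmax"
    and M_prob: "prob_space M"
    and T_indep: "prob_space.indep_vars M (\<lambda>_. N) T {1..B}"
    and T_distr: "\<And>i. i \<in> {1..B} \<Longrightarrow> distributed M N (T i) (\<lambda>\<tau>. ennreal (p \<tau>))"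
  shows "measure M {\<omega> \<in> space M.
           tail_risk N p r \<alpha> \<theta>s
             \<le> empirical_tail_risk \<alpha> B (\<lambda>i. r (T i \<omega>) \<theta>s)
               + sqrt (2 * (\<alpha> / (1 - \<alpha>) * Lmax\<^sup>2 + tail_variance N p r \<alpha> \<theta>s)
                        * ln (1 / \<epsilon>) / real B)
               + 1 / (3 * (1 - \<alpha>)) * (Lmax / real B)
                   * (2 * ln (1 / \<epsilon>) + 3 * \<alpha> * real B)}
         \<ge> 1 - \<epsilon>"
proof -
  interpret M: prob_space M by fact
  define D where "D = density N (\<lambda>\<tau>. ennreal (p \<tau>))"
  define \<rho> where "\<rho> = (\<lambda>\<tau>. r \<tau> \<theta>s)"
  define \<mu> where "\<mu> = distr D borel \<rho>"
  define \<nu> where "\<nu> = distr (tail_measure N p r \<alpha> \<theta>s) borel \<rho>"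
  define \<xi> where "\<xi> = VaR N p r \<alpha> \<theta>s"
  define t where "t = ln (1 / \<epsilon>)"
  define C where "C = tail_region N p r \<alpha> \<theta>s"
  note p_measurable[measurable]
  have \<rho>[measurable]: "\<rho> \<in> borel_measurable N" unfolding \<rho>_def by (rule r_measurable[OF \<theta>_mem])
  have sets_D[measurable_cong]: "sets D = sets N" and sp_D: "space D = space N" by (simp_all add: D_def)
  interpret D: prob_space D unfolding D_def by (rule p_prob)
  interpret \<mu>: prob_space \<mu> unfolding \<mu>_def by (rule D.prob_space_distr) simp
  have meas_\<mu>: "measure \<mu> E = measure D {\<tau> \<in> space N. \<rho> \<tau> \<in> E}" if "E \<in> sets borel" for E
    using that unfolding \<mu>_def by (subst measure_distr) (auto simp: sp_D intro!: arg_cong[where f = "measure D"])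
  have cdf: "risk_cdf N p r \<theta>s = (\<lambda>x. measure \<mu> {..x})"
    by (auto simp: risk_cdf_def meas_\<mu> D_def \<rho>_def)
  have AE_\<mu>: "AE x in \<mu>. P x" if "\<And>\<tau>. \<tau> \<in> space N \<Longrightarrow> P (\<rho> \<tau>)" "{x. P x} \<in> sets borel" for P
    unfolding \<mu>_def using that by (subst AE_distr_iff) (auto simp: sp_D intro!: AE_I2)
  have \<rho>0: "0 \<le> \<rho> \<tau>" if "\<tau> \<in> space N" for \<tau>
    using r_nonneg[OF that \<theta>_mem] by (simp add: \<rho>_def)
  have q: "measure \<mu> {\<xi>..} = 1 - \<alpha>" "measure \<mu> {..0} = 0"
  proof -
    have "AE x in \<mu>. 0 \<le> x" by (rule AE_\<mu>) (auto simp: \<rho>0)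
    moreover have "sets \<mu> = sets borel" by (simp add: \<mu>_def)
    ultimately show "measure \<mu> {\<xi>..} = 1 - \<alpha>" "measure \<mu> {..0} = 0"
      using tail_measure_quantile[of \<mu> \<beta>\<^sub>l \<alpha>] cdf_lipschitz[OF \<theta>_mem] \<alpha>_range \<mu>.prob_space_axioms
      by (auto simp: cdf \<xi>_def VaR_def)
  qed

  have C: "C = {\<tau> \<in> space N. \<xi> \<le> \<rho> \<tau>}" by (simp add: C_def tail_region_def \<xi>_def \<rho>_def)
  have \<rho>_C: "\<rho> \<tau> \<le> Lmax" if "\<tau> \<in> C" for \<tau>
  proof -
    have "ereal (\<rho> \<tau>) \<le> (SUP \<tau>\<in>C. ereal (\<rho> \<tau>))" by (rule SUP_upper[OF that])
    also have "\<dots> \<le> ereal Lmax" using tail_bound[OF \<theta>_mem] by (simp add: C_def \<rho>_def)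
    finally show ?thesis by simp
  qed
  \<comment> \<open>The tail region has positive mass, so some task has a risk between \<xi> and
    \<open>Lmax\<close>. Hence \<open>\<xi> \<le> Lmax\<close>, and the bound assumed on the tail
    extends to the tasks below \<xi>.\<close>
  have "measure D C = 1 - \<alpha>" using q(1) by (simp add: C meas_\<mu>)
  then have "C \<noteq> {}" using \<alpha>_range by auto
  then obtain \<tau>0 where "\<tau>0 \<in> C" by auto
  then have "\<xi> \<le> Lmax" using \<rho>_C[of \<tau>0] by (auto simp: C)
  then have \<rho>L: "\<rho> \<tau> \<le> Lmax" if "\<tau> \<in> space N" for \<tau>
    using \<rho>_C[of \<tau>] that by (force simp: C)
  \<comment> \<open>Otherwise no risk would be positive, although \<open>{..0}\<close> is null for
    \<open>\<mu>\<close>.\<close>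
  have L: "0 < Lmax"
  proof (rule ccontr)
    assume "\<not> 0 < Lmax"
    then have "{\<tau> \<in> space N. \<rho> \<tau> \<in> {..0}} = space D" using \<rho>L by (force simp: sp_D)
    then show False using q(2) D.prob_space by (simp add: meas_\<mu>)
  qed

  have sets_tm[measurable_cong]: "sets (tail_measure N p r \<alpha> \<theta>s) = sets N" by (simp add: tail_measure_def)
  have sp_tm: "space (tail_measure N p r \<alpha> \<theta>s) = space N" by (simp add: tail_measure_def)
  have em_\<nu>: "emeasure \<nu> E = ennreal (measure \<mu> (E \<inter> {\<xi>..}) / (1 - \<alpha>))" if E[measurable]: "E \<in> sets borel" for E
  proof -
    have "emeasure \<nu> E = emeasure (tail_measure N p r \<alpha> \<theta>s) (\<rho> -` E \<inter> space N)"
      unfolding \<nu>_def by (subst emeasure_distr) (auto simp: sp_tm)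
    also have "\<dots> = ennreal (1 / (1 - \<alpha>)) * emeasure D ((\<rho> -` E \<inter> space N) \<inter> C)"
      unfolding D_def C_def using p_nonneg \<alpha>_range \<rho>[unfolded \<rho>_def]
      by (intro emeasure_tail_measure) auto
    also have "(\<rho> -` E \<inter> space N) \<inter> C = {\<tau> \<in> space N. \<rho> \<tau> \<in> E \<inter> {\<xi>..}}" by (auto simp: C)
    also have "emeasure D \<dots> = ennreal (measure \<mu> (E \<inter> {\<xi>..}))"
      by (subst meas_\<mu>) (auto simp: D.emeasure_eq_measure)
    finally show ?thesis using \<alpha>_range by (simp flip: ennreal_mult)
  qed
  \<comment> \<open>The factor \<open>1 / (1 - \<alpha>)\<close> normalizes because the tail mass is
    exactly \<open>1 - \<alpha>\<close>.\<close>
  have \<nu>: "prob_space \<nu>" "sets \<nu> = sets borel"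
  proof
    show "emeasure \<nu> (space \<nu>) = 1"
      using em_\<nu>[of UNIV] q(1) \<alpha>_range by (simp add: \<nu>_def[THEN arg_cong[where f = space]])
  qed (simp add: \<nu>_def)
  interpret \<nu>: prob_space \<nu> by fact
  have tail: "measure \<mu> (E \<inter> {\<xi>..}) = (1 - \<alpha>) * measure \<nu> E" if "E \<in> sets borel" for E
    using em_\<nu>[OF that] \<alpha>_range by (simp add: \<nu>.emeasure_eq_measure)

  have tr: "(\<integral>\<tau>. g (\<rho> \<tau>) \<partial>tail_measure N p r \<alpha> \<theta>s) = (\<integral>x. g x \<partial>\<nu>)"
    if "g \<in> borel_measurable borel" for g :: "real \<Rightarrow> real"
    unfolding \<nu>_def using that by (subst integral_distr) auto
  define R where "R = tail_risk N p r \<alpha> \<theta>s"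
  define V where "V = tail_variance N p r \<alpha> \<theta>s"
  have R: "R = (\<integral>x. x \<partial>\<nu>)"
    using tr[of "\<lambda>x. x"] by (simp add: R_def tail_risk_def \<rho>_def)
  have V: "V = (\<integral>x. (x - (\<integral>x. x \<partial>\<nu>))\<^sup>2 \<partial>\<nu>)"
    using tr[of "\<lambda>x. (x - (\<integral>x. x \<partial>\<nu>))\<^sup>2"] R
    by (simp add: V_def tail_variance_def R_def tail_risk_def \<rho>_def)
  have V0: "0 \<le> V" unfolding V by (rule Bochner_Integration.integral_nonneg) simp
  have t: "0 < t" using \<epsilon>_range by (simp add: t_def)

  \<comment> \<open>The full slack of the bound: it fails exactly when the estimator is below
    \<open>R - d\<close>.\<close>
  define d where "d = sqrt (2 * (\<alpha> / (1 - \<alpha>) * Lmax\<^sup>2 + V) * t / real B)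
      + 1 / (3 * (1 - \<alpha>)) * (Lmax / real B) * (2 * t + 3 * \<alpha> * real B)"
  let ?X = "\<lambda>\<omega>. \<lambda>i\<in>{1..B}. \<rho> (T i \<omega>)"
  have T[measurable]: "T i \<in> measurable M N" if "i \<in> {1..B}" for i
    using T_distr[OF that] by (simp add: distributed_def)
  have X_distr: "distr M borel (\<lambda>\<omega>. \<rho> (T i \<omega>)) = \<mu>" if "i \<in> {1..B}" for i
    using T_distr[OF that] distr_distr[OF \<rho> T[OF that]]
    by (simp add: distributed_def \<mu>_def D_def comp_def)
  have "M.indep_vars (\<lambda>_. borel) (\<lambda>i \<omega>. \<rho> (T i \<omega>)) {1..B}"
    by (rule M.indep_vars_compose2[OF T_indep]) simp
  then have X_PiM: "distr M (PiM {1..B} (\<lambda>_. borel)) ?X = PiM {1..B} (\<lambda>_. \<mu>)"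
    using B_pos by (intro M.distr_PiM_iid X_distr) auto
  have X_meas[measurable]: "?X \<in> measurable M (PiM {1..B} (\<lambda>_. borel))"
    by (intro measurable_restrict) auto
  have emp[measurable]: "empirical_tail_risk \<alpha> B \<in> borel_measurable (PiM {1..B} (\<lambda>_. borel))"
    using \<alpha>_range by (intro empirical_tail_risk_measurable) simp
  let ?bad = "{x \<in> space (PiM {1..B} (\<lambda>_. borel)). empirical_tail_risk \<alpha> B x < R - d}"
  have bad_sets: "?bad \<in> sets (PiM {1..B} (\<lambda>_. borel))" by measurable
  have "sets (PiM {1..B} (\<lambda>_. \<mu>)) = sets (PiM {1..B} (\<lambda>_. borel))"
    by (rule sets_PiM_cong) (auto simp: \<mu>_def)
  then have sp_PiM: "space (PiM {1..B} (\<lambda>_. \<mu>)) = space (PiM {1..B} (\<lambda>_. borel))"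
    by (rule sets_eq_imp_space_eq)
  have "M.prob (?X -` ?bad \<inter> space M) = measure (PiM {1..B} (\<lambda>_. \<mu>)) ?bad"
    unfolding X_PiM[symmetric] by (rule measure_distr[OF X_meas bad_sets, symmetric])
  also have "\<dots> \<le> exp (- t)"
    unfolding sp_PiM[symmetric]
  proof (rule empirical_tail_risk_bound[where L = Lmax and \<nu> = \<nu> and \<xi> = \<xi>])
    show "AE x in \<mu>. 0 \<le> x \<and> x \<le> Lmax" using \<rho>0 \<rho>L by (intro AE_\<mu>) auto
    show "R - d \<le> \<integral>x. x \<partial>\<nu> - \<alpha> * Lmax
        - (sqrt (2 * (real B * ((\<integral>x. (x - (\<integral>x. x \<partial>\<nu>))\<^sup>2 \<partial>\<nu>) + \<alpha> * (1 - \<alpha>) * Lmax\<^sup>2)) * t)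
           + 2 * Lmax * t / 3) / real B"
      unfolding R[symmetric] V[symmetric, unfolded R[symmetric]] d_def
      using L V0 \<alpha>_range t B_pos by (intro tail_bound_arith) auto
  qed (use \<nu> q tail L \<alpha>_range B_pos t \<mu>.prob_space_axioms in \<open>auto simp: \<mu>_def[THEN arg_cong[where f = sets]]\<close>)
  also have "exp (- t) = \<epsilon>" using \<epsilon>_range by (simp add: t_def ln_div)
  finally have bad: "M.prob (?X -` ?bad \<inter> space M) \<le> \<epsilon>" .
  have "{\<omega> \<in> space M. R \<le> empirical_tail_risk \<alpha> B (\<lambda>i. r (T i \<omega>) \<theta>s) + d} = space M - (?X -` ?bad \<inter> space M)"
  proof -
    have "empirical_tail_risk \<alpha> B (?X \<omega>) = empirical_tail_risk \<alpha> B (\<lambda>i. r (T i \<omega>) \<theta>s)" for \<omega>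
      by (rule empirical_tail_risk_cong) (simp add: \<rho>_def)
    then show ?thesis using measurable_space[OF X_meas] by (auto simp: not_less diff_le_eq)
  qed
  moreover have "?X -` ?bad \<inter> space M \<in> M.events" by (rule measurable_sets[OF X_meas bad_sets])
  ultimately have "1 - \<epsilon> \<le> M.prob {\<omega> \<in> space M. R \<le> empirical_tail_risk \<alpha> B (\<lambda>i. r (T i \<omega>) \<theta>s) + d}"
    using bad by (simp add: M.prob_compl)
  then show ?thesis by (simp add: d_def R_def V_def t_def add.assoc)
qed

end
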